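(* If $H_{20}$ is an anti-twinned signified graph on $20$ vertices such that every signified graph whose underlying graph is planar admits a signified homomorphism to $H_{20}$, then $H_{20}$ is isomorphic (by a sign-preserving isomorphism) to $Tr(SP_9)$.
   Context: A signified graph $(G,\Sigma)$ is a simple graph $G$ with a set $\Sigma\subseteq E(G)$ of negative edges, other edges positive. A signified homomorphism is a vertex map sending every edge to an edge of the same sign. For a signified graph $(H,\Lambda)$, $AT(H,\Lambda)$ has vertex set $\{u_0,u_1:u\in V(H)\}$; for every edge $uv$ of $H$ it has edges $u_0v_0,u_1v_1$ with the sign of $uv$ and $u_0v_1,u_1v_0$ with the opposite sign; no other edges. A signified graph is anti-twinned if it is isomorphic to $AT(H,\Lambda)$ for some signified graph $(H,\Lambda)$. $SP_9$ is the complete graph on $\mathbb{F}_9$ where $xy$ is negative iff $y-x$ is a non-square in $\mathbb{F}_9$; $SP_9^+$ is $SP_9$ plus a new vertex joined by positive edges to all nine vertices; and $Tr(SP_9)=AT(SP_9^+)$ (20 vertices). *)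

theory Defs
  imports "HOL-Analysis.Analysis"
begin

text \<open>A signified graph is given by a vertex set V, a set E of edges (2-element
subsets of V) and a set N \<subseteq> E of negative edges; the other edges are positive.\<close>

definition signified_graph :: "'a set \<Rightarrow> 'a set set \<Rightarrow> 'a set set \<Rightarrow> bool" where
  "signified_graph V E N \<longleftrightarrow> finite V \<and> (\<forall>e\<in>E. e \<subseteq> V \<and> card e = 2) \<and> N \<subseteq> E"

definition signified_hom ::
  "'a set \<Rightarrow> 'a set set \<Rightarrow> 'a set set \<Rightarrow> 'b set \<Rightarrow> 'b set set \<Rightarrow> 'b set set \<Rightarrow> ('a \<Rightarrow> 'b) \<Rightarrow> bool" where
  "signified_hom V E N W F M f \<longleftrightarrow>
     f ` V \<subseteq> W \<and>
     (\<forall>u\<in>V. \<forall>v\<in>V. {u,v} \<in> E \<longrightarrow> {f u, f v} \<in> F \<and> ({u,v} \<in> N \<longleftrightarrow> {f u, f v} \<in> M))"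

definition signified_iso ::
  "'a set \<Rightarrow> 'a set set \<Rightarrow> 'a set set \<Rightarrow> 'b set \<Rightarrow> 'b set set \<Rightarrow> 'b set set \<Rightarrow> ('a \<Rightarrow> 'b) \<Rightarrow> bool" where
  "signified_iso V E N W F M f \<longleftrightarrow>
     bij_betw f V W \<and>
     (\<forall>u\<in>V. \<forall>v\<in>V. ({u,v} \<in> E \<longleftrightarrow> {f u, f v} \<in> F) \<and> ({u,v} \<in> N \<longleftrightarrow> {f u, f v} \<in> M))"

definition signified_isomorphic ::
  "'a set \<Rightarrow> 'a set set \<Rightarrow> 'a set set \<Rightarrow> 'b set \<Rightarrow> 'b set set \<Rightarrow> 'b set set \<Rightarrow> bool" where
  "signified_isomorphic V E N W F M \<longleftrightarrow> (\<exists>f. signified_iso V E N W F M f)"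

text \<open>The anti-twinned graph AT(H,\<Lambda>): vertices (u,False) = u_0 and (u,True) = u_1.\<close>
definition AT_verts :: "'a set \<Rightarrow> ('a \<times> bool) set" where
  "AT_verts V = V \<times> UNIV"

definition AT_edges :: "'a set set \<Rightarrow> ('a \<times> bool) set set" where
  "AT_edges E = {{(u,i),(v,j)} | u v i j. {u,v} \<in> E}"

definition AT_neg :: "'a set set \<Rightarrow> 'a set set \<Rightarrow> ('a \<times> bool) set set" where
  "AT_neg E N = {{(u,i),(v,j)} | u v i j. {u,v} \<in> E \<and> ({u,v} \<in> N \<longleftrightarrow> i = j)}"

text \<open>Anti-twinned: isomorphic to AT(H,\<Lambda>) for some signified graph (H,\<Lambda>)
(vertices of H taken in nat, which loses no generality for finite graphs).\<close>
definition anti_twinned :: "'a set \<Rightarrow> 'a set set \<Rightarrow> 'a set set \<Rightarrow> bool" where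
  "anti_twinned V E N \<longleftrightarrow>
     (\<exists>(VH::nat set) EH NH. signified_graph VH EH NH \<and>
        signified_isomorphic V E N (AT_verts VH) (AT_edges EH) (AT_neg EH NH))"

definition planar :: "'a set \<Rightarrow> 'a set set \<Rightarrow> bool" where
  "planar V E \<longleftrightarrow>
     (\<exists>(p :: 'a \<Rightarrow> real^2) (\<gamma> :: 'a set \<Rightarrow> real \<Rightarrow> real^2).
        inj_on p V \<and>
        (\<forall>e\<in>E. arc (\<gamma> e) \<and> {pathstart (\<gamma> e), pathfinish (\<gamma> e)} = p ` e \<and>
                 path_image (\<gamma> e) \<inter> p ` V = p ` e) \<and>
        (\<forall>e\<in>E. \<forall>e'\<in>E. e \<noteq> e' \<longrightarrow> path_image (\<gamma> e) \<inter> path_image (\<gamma> e') \<subseteq> p ` (e \<inter> e')))"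

text \<open>The field F_9 modelled as F_3[i] with i^2 = -1: pairs (a,b) with a,b \<in> {0,1,2}.\<close>
definition F9 :: "(int \<times> int) set" where
  "F9 = {0..2} \<times> {0..2}"

definition F9_mult :: "int \<times> int \<Rightarrow> int \<times> int \<Rightarrow> int \<times> int" where
  "F9_mult x y = ((fst x * fst y - snd x * snd y) mod 3, (fst x * snd y + snd x * fst y) mod 3)"

definition F9_sub :: "int \<times> int \<Rightarrow> int \<times> int \<Rightarrow> int \<times> int" where
  "F9_sub x y = ((fst x - fst y) mod 3, (snd x - snd y) mod 3)"

definition F9_square :: "int \<times> int \<Rightarrow> bool" where
  "F9_square x \<longleftrightarrow> (\<exists>y\<in>F9. F9_mult y y = x)"

definition SP9p_verts :: "(int \<times> int) option set" where
  "SP9p_verts = Some ` F9 \<union> {None}"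

definition SP9p_edges :: "(int \<times> int) option set set" where
  "SP9p_edges = {{u,v} | u v. u \<in> SP9p_verts \<and> v \<in> SP9p_verts \<and> u \<noteq> v}"

definition SP9p_neg :: "(int \<times> int) option set set" where
  "SP9p_neg = {{Some x, Some y} | x y. x \<in> F9 \<and> y \<in> F9 \<and> x \<noteq> y \<and> \<not> F9_square (F9_sub y x)}"

definition Tr_SP9_verts where "Tr_SP9_verts = AT_verts SP9p_verts"
definition Tr_SP9_edges where "Tr_SP9_edges = AT_edges SP9p_edges"
definition Tr_SP9_neg where "Tr_SP9_neg = AT_neg SP9p_edges SP9p_neg"

end

theory Submission
  imports Defs
begin

text \<open>Write \<open>V\<close> as \<open>AT(H)\<close> with \<open>H\<close> on ten vertices. Along an edge \<open>uv\<close> of a plane graph one can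
stack a path \<open>p\<^sub>0 \<dots> p\<^sub>9\<close>, all of whose vertices are joined to \<open>u\<close> and \<open>v\<close>, where \<open>u p\<^sub>i\<close> is positive,
\<open>v p\<^sub>i\<close> is positive for \<open>i < 5\<close> and negative for \<open>i \<ge> 5\<close>, and the signs along the path alternate.
After switching in \<open>H\<close>, a path on five vertices with alternating signs has an image with at least four
vertices, since a signed triangle contains no such walk. The two halves go to disjoint sets, so
the eight vertices of \<open>H\<close> other than the images \<open>h, k\<close> of \<open>u, v\<close> are all hit, and
\<open>h, k\<close> have equal signs at exactly four of them. Three rounds of stacking such paths along every edge give a planar
graph in which every pair \<open>h \<noteq> k\<close> of \<open>H\<close> is the image of such an edge. So \<open>H\<close> is, up to switching,
a symmetric conference matrix of order 10, whose switching at one vertex leaves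
a strongly regular graph (9,4,1,2), i.e. the 3 by 3 rook's graph. This is the
positive graph of \<open>SP\<^sub>9\<close>, because the nonzero squares of \<open>F\<^sub>9 = F\<^sub>3[i]\<close> are \<open>\<plusminus>1, \<plusminus>i\<close>.\<close>

section \<open>Stacked straight-line drawings\<close>

text \<open>Affine independence, in the form needed to compare barycentric coordinates.\<close>
definition tri :: "'p::real_vector \<Rightarrow> 'p \<Rightarrow> 'p \<Rightarrow> bool" where
  "tri a b c \<longleftrightarrow> (\<forall>u v w. u + v + w = 0 \<longrightarrow> u *\<^sub>R a + v *\<^sub>R b + w *\<^sub>R c = 0 \<longrightarrow> u = 0 \<and> v = 0 \<and> w = 0)"

definition is_tri :: "'p::real_vector set \<Rightarrow> bool" where
  "is_tri f \<longleftrightarrow> (\<exists>a b c. f = {a,b,c} \<and> tri a b c)"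

lemma is_triI: "tri a b c \<Longrightarrow> is_tri {a,b,c}"
  unfolding is_tri_def by blast

text \<open>Indexed by the set of corners, since faces are kept as sets; \<open>open_tri_iff\<close>
  recovers ordered coordinates once the corners are affinely independent.\<close>

definition open_tri :: "'p::real_vector set \<Rightarrow> 'p set" where
  "open_tri f = {\<Sum>y\<in>f. w y *\<^sub>R y | w. (\<forall>y\<in>f. 0 < w y) \<and> sum w f = 1}"

lemma tri_unique:
  assumes "tri a b c" "u + v + w = u' + v' + w'"
    "u *\<^sub>R a + v *\<^sub>R b + w *\<^sub>R c = u' *\<^sub>R a + v' *\<^sub>R b + w' *\<^sub>R c"
  shows "u = u'" "v = v'" "w = w'"
proof -
  have "(u - u') + (v - v') + (w - w') = 0" using assms(2) by linarith
  moreover have "(u - u') *\<^sub>R a + (v - v') *\<^sub>R b + (w - w') *\<^sub>R c = 0"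
    using assms(3) by (simp add: algebra_simps)
  ultimately have "u - u' = 0 \<and> v - v' = 0 \<and> w - w' = 0"
    using assms(1) unfolding tri_def by blast
  then show "u = u'" "v = v'" "w = w'" by auto
qed

lemma tri_perm:
  assumes "tri a b c" shows "tri b a c" "tri a c b"
proof -
  show "tri b a c" unfolding tri_def
  proof (intro allI impI)
    fix u v w assume h: "u + v + w = 0" "u *\<^sub>R b + v *\<^sub>R a + w *\<^sub>R c = 0"
    have "v + u + w = 0" "v *\<^sub>R a + u *\<^sub>R b + w *\<^sub>R c = 0" using h by (simp_all add: ac_simps)
    then show "u = 0 \<and> v = 0 \<and> w = 0" using assms unfolding tri_def by blast
  qed
  show "tri a c b" unfolding tri_def
  proof (intro allI impI)
    fix u v w assume h: "u + v + w = 0" "u *\<^sub>R a + v *\<^sub>R c + w *\<^sub>R b = 0"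
    have "u + w + v = 0" "u *\<^sub>R a + w *\<^sub>R b + v *\<^sub>R c = 0" using h by (simp_all add: ac_simps)
    then show "u = 0 \<and> v = 0 \<and> w = 0" using assms unfolding tri_def by blast
  qed
qed

lemma tri_distinct:
  assumes "tri a b c" shows "a \<noteq> b" "a \<noteq> c" "b \<noteq> c"
proof -
  show "a \<noteq> b" using tri_unique(1)[OF assms, of 1 0 0 0 1 0] by auto
  show "a \<noteq> c" using tri_unique(1)[OF assms, of 1 0 0 0 0 1] by auto
  show "b \<noteq> c" using tri_unique(2)[OF assms, of 0 1 0 0 0 1] by auto
qed

lemma open_tri_iff:
  assumes "tri a b c"
  shows "x \<in> open_tri {a,b,c} \<longleftrightarrow>
    (\<exists>u v w. 0 < u \<and> 0 < v \<and> 0 < w \<and> u + v + w = 1 \<and> x = u *\<^sub>R a + v *\<^sub>R b + w *\<^sub>R c)"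
proof
  assume "x \<in> open_tri {a,b,c}"
  then show "\<exists>u v w. 0 < u \<and> 0 < v \<and> 0 < w \<and> u + v + w = 1 \<and> x = u *\<^sub>R a + v *\<^sub>R b + w *\<^sub>R c"
    using tri_distinct[OF assms] unfolding open_tri_def
    by (auto simp: add.assoc)
next
  assume "\<exists>u v w. 0 < u \<and> 0 < v \<and> 0 < w \<and> u + v + w = 1 \<and> x = u *\<^sub>R a + v *\<^sub>R b + w *\<^sub>R c"
  then obtain u v w where h: "0 < u" "0 < v" "0 < w" "u + v + w = 1"
      "x = u *\<^sub>R a + v *\<^sub>R b + w *\<^sub>R c" by blast
  show "x \<in> open_tri {a,b,c}" unfolding open_tri_def
    apply (rule CollectI, rule exI[of _ "\<lambda>y. if y = a then u else if y = b then v else w"])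
    using h tri_distinct[OF assms] by (auto simp: add.assoc)
qed

definition centroid3 :: "'p::real_vector \<Rightarrow> 'p \<Rightarrow> 'p \<Rightarrow> 'p" where
  "centroid3 a b c = (1/3) *\<^sub>R (a + b + c)"

lemma centroid3_perm: "centroid3 b a c = centroid3 a b c" "centroid3 a c b = centroid3 a b c"
  by (simp_all add: centroid3_def ac_simps)

text \<open>A weight \<open>w\<close> on the centroid is \<open>w/3\<close> on each corner, and this
  change of coefficients is invertible.\<close>

lemma tri_centroid3:
  assumes "tri a b c" shows "tri a b (centroid3 a b c)"
  unfolding tri_def
proof (intro allI impI)
  fix u v w :: real
  assume h: "u + v + w = 0" "u *\<^sub>R a + v *\<^sub>R b + w *\<^sub>R centroid3 a b c = 0"
  have "(u + w/3) *\<^sub>R a + (v + w/3) *\<^sub>R b + (w/3) *\<^sub>R c = 0"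
    using h(2) by (simp add: centroid3_def algebra_simps)
  moreover have "(u + w/3) + (v + w/3) + w/3 = 0" using h(1) by simp
  ultimately have "u + w/3 = 0 \<and> v + w/3 = 0 \<and> w/3 = 0" using assms unfolding tri_def by blast
  then show "u = 0 \<and> v = 0 \<and> w = 0" by auto
qed

text \<open>In barycentric coordinates, the three triangles cut out by the centroid are told apart by
  which coordinate is the strictly smallest, and the three new edges by which two are equal and
  smallest.\<close>
lemma open_tri_centroid3E:
  assumes "tri a b c" "x \<in> open_tri {a, b, centroid3 a b c}"
  obtains u v w where "u + v + w = 1" "x = u *\<^sub>R a + v *\<^sub>R b + w *\<^sub>R c" "0 < w" "w < u" "w < v"
proof -
  obtain u v w where h: "0 < u" "0 < v" "0 < w" "u + v + w = 1"
      "x = u *\<^sub>R a + v *\<^sub>R b + w *\<^sub>R centroid3 a b c"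
    using assms open_tri_iff[OF tri_centroid3[OF assms(1)]] by auto
  have "(u + w/3) + (v + w/3) + w/3 = 1" using h by simp
  moreover have "x = (u + w/3) *\<^sub>R a + (v + w/3) *\<^sub>R b + (w/3) *\<^sub>R c"
    using h by (simp add: centroid3_def algebra_simps)
  ultimately show thesis using that[of "u + w/3" "v + w/3" "w/3"] h by auto
qed

lemma hull_centroid3E:
  assumes "x \<in> convex hull {centroid3 a b c, a}"
  obtains u w where "u + w + w = 1" "x = u *\<^sub>R a + w *\<^sub>R b + w *\<^sub>R c" "0 \<le> w" "w \<le> u"
proof -
  obtain t s where h: "0 \<le> t" "0 \<le> s" "t + s = 1" "x = t *\<^sub>R centroid3 a b c + s *\<^sub>R a"
    using assms by (auto simp: convex_hull_2)
  have "(s + t/3) + t/3 + t/3 = 1" using h by simp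
  moreover have "x = (s + t/3) *\<^sub>R a + (t/3) *\<^sub>R b + (t/3) *\<^sub>R c"
    using h by (simp add: centroid3_def algebra_simps)
  ultimately show thesis using that[of "s + t/3" "t/3"] h by auto
qed

lemma open_tri_centroid3_subset:
  assumes "tri a b c"
  shows "open_tri {a, b, centroid3 a b c} \<subseteq> open_tri {a,b,c}"
proof
  fix x assume x: "x \<in> open_tri {a, b, centroid3 a b c}"
  obtain u v w where "u + v + w = 1" "x = u *\<^sub>R a + v *\<^sub>R b + w *\<^sub>R c" "0 < w" "w < u" "w < v"
    by (rule open_tri_centroid3E[OF assms x])
  then show "x \<in> open_tri {a,b,c}" unfolding open_tri_iff[OF assms]
    by (intro exI[of _ u] exI[of _ v] exI[of _ w]) auto
qed

lemma hull_centroid3_subset: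
  assumes "tri a b c"
  shows "convex hull {centroid3 a b c, a} \<subseteq> insert a (open_tri {a,b,c})"
proof
  fix x assume x: "x \<in> convex hull {centroid3 a b c, a}"
  obtain u w where h: "u + w + w = 1" "x = u *\<^sub>R a + w *\<^sub>R b + w *\<^sub>R c" "0 \<le> w" "w \<le> u"
    by (rule hull_centroid3E[OF x])
  show "x \<in> insert a (open_tri {a,b,c})"
  proof (cases "w = 0")
    case True then show ?thesis using h by auto
  next
    case False
    then show ?thesis unfolding insert_iff open_tri_iff[OF assms] using h
      by (intro disjI2 exI[of _ u] exI[of _ w]) auto
  qed
qed

text \<open>The coordinates have the form \<open>(u,w,w)\<close> on one spoke and
  \<open>(w',u',w')\<close> on the other, so a common point has all three equal.\<close>

lemma hull_centroid3_Int:
  assumes "tri a b c"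
  shows "convex hull {centroid3 a b c, a} \<inter> convex hull {centroid3 a b c, b} \<subseteq> {centroid3 a b c}"
proof
  fix x assume x: "x \<in> convex hull {centroid3 a b c, a} \<inter> convex hull {centroid3 a b c, b}"
  then have x1: "x \<in> convex hull {centroid3 a b c, a}" and x2: "x \<in> convex hull {centroid3 b a c, b}"
    by (auto simp: centroid3_perm)
  obtain u w where h: "u + w + w = 1" "x = u *\<^sub>R a + w *\<^sub>R b + w *\<^sub>R c"
    by (rule hull_centroid3E[OF x1])
  obtain u' w' where h': "u' + w' + w' = 1" "x = u' *\<^sub>R b + w' *\<^sub>R a + w' *\<^sub>R c"
    by (rule hull_centroid3E[OF x2])
  have e: "u = w'" "w = u'" "w = w'"
    using tri_unique[OF assms, of u w w w' u' w'] h h' by (auto simp: ac_simps)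
  then have "w = 1/3" "u = 1/3" using h by auto
  then have "x = (1/3) *\<^sub>R a + (1/3) *\<^sub>R b + (1/3) *\<^sub>R c" using h(2) by (simp only:)
  then show "x \<in> {centroid3 a b c}" by (simp add: centroid3_def scaleR_right_distrib)
qed

lemma open_tri_hull_centroid3_disjoint:
  assumes "tri a b c" "y \<in> {a,b,c}"
  shows "open_tri {a, b, centroid3 a b c} \<inter> convex hull {centroid3 a b c, y} = {}"
proof (rule ccontr)
  assume "\<not> ?thesis"
  then obtain x where x: "x \<in> open_tri {a, b, centroid3 a b c}"
    and xy: "x \<in> convex hull {centroid3 a b c, y}" by blast
  obtain u v w where h: "u + v + w = 1" "x = u *\<^sub>R a + v *\<^sub>R b + w *\<^sub>R c" "0 < w" "w < u" "w < v"
    by (rule open_tri_centroid3E[OF assms(1) x])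
  consider "y = a" | "y = b" | "y = c" using assms(2) by auto
  then show False
  proof cases
    case 1
    then have "x \<in> convex hull {centroid3 a b c, a}" using xy by simp
    then obtain s t where g: "s + t + t = 1" "x = s *\<^sub>R a + t *\<^sub>R b + t *\<^sub>R c" by (rule hull_centroid3E)
    show False using tri_unique[OF assms(1), of u v w s t t] h g by simp
  next
    case 2
    then have "x \<in> convex hull {centroid3 b a c, b}" using xy by (simp add: centroid3_perm)
    then obtain s t where g: "s + t + t = 1" "x = s *\<^sub>R b + t *\<^sub>R a + t *\<^sub>R c" by (rule hull_centroid3E)
    show False using tri_unique[OF assms(1), of u v w t s t] h g by (simp add: ac_simps)
  next
    \<comment> \<open>On the spoke to \<open>c\<close> the coordinate of \<open>c\<close> is a
      largest one, whereas in the open triangle it is the strictly smallest.\<close>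
    case 3
    then have "x \<in> convex hull {centroid3 c a b, c}" using xy by (metis centroid3_perm)
    then obtain s t where g: "s + t + t = 1" "x = s *\<^sub>R c + t *\<^sub>R a + t *\<^sub>R b" "t \<le> s" by (rule hull_centroid3E)
    show False using tri_unique[OF assms(1), of u v w t t s] h g by (simp add: ac_simps)
  qed
qed

lemma open_tri_centroid3_disjoint:
  assumes "tri a b c"
  shows "open_tri {a, b, centroid3 a b c} \<inter> open_tri {a, c, centroid3 a b c} = {}"
proof (rule ccontr)
  assume "\<not> ?thesis"
  then obtain x where x: "x \<in> open_tri {a, b, centroid3 a b c}" "x \<in> open_tri {a, c, centroid3 a c b}"
    by (auto simp: centroid3_perm)
  obtain u v w where h: "u + v + w = 1" "x = u *\<^sub>R a + v *\<^sub>R b + w *\<^sub>R c" "0 < w" "w < u" "w < v"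
    by (rule open_tri_centroid3E[OF assms(1) x(1)])
  obtain u' v' w' where h': "u' + v' + w' = 1" "x = u' *\<^sub>R a + v' *\<^sub>R c + w' *\<^sub>R b" "w' < v'"
    by (rule open_tri_centroid3E[OF tri_perm(2)[OF assms] x(2)])
  show False using tri_unique[OF assms(1), of u v w u' w' v'] h h' by (simp add: ac_simps)
qed

lemma hull_side_Int:
  assumes "tri a b c"
  shows "convex hull {a,b} \<inter> convex hull {a,c} \<subseteq> {a}"
proof
  fix x assume "x \<in> convex hull {a,b} \<inter> convex hull {a,c}"
  then obtain s t s' t' where "s + t = 1" "x = s *\<^sub>R a + t *\<^sub>R b" "s' + t' = 1" "x = s' *\<^sub>R a + t' *\<^sub>R c"
    by (auto simp: convex_hull_2)
  then show "x \<in> {a}" using tri_unique[OF assms, of s t 0 s' 0 t'] by auto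
qed

lemma open_tri_hull_side_disjoint:
  assumes "tri a b c"
  shows "open_tri {a,b,c} \<inter> convex hull {a,b} = {}"
proof (rule ccontr)
  assume "\<not> ?thesis"
  then obtain x where x: "x \<in> open_tri {a,b,c}" "x \<in> convex hull {a,b}" by blast
  obtain u v w where h: "u + v + w = 1" "0 < w" "x = u *\<^sub>R a + v *\<^sub>R b + w *\<^sub>R c"
    using x(1) open_tri_iff[OF assms] by auto
  obtain s t where "s + t = 1" "x = s *\<^sub>R a + t *\<^sub>R b" using x(2) by (auto simp: convex_hull_2)
  then show False using tri_unique[OF assms, of u v w s t 0] h by auto
qed

text \<open>The vertices are points and the edges straight segments. \<open>F\<close> lists triangles with empty
  interior; it need not contain every face, only one next to each edge.\<close>
locale plane_graph =
  fixes V :: "'p::real_vector set" and E F :: "'p set set"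
  assumes finite_V: "finite V"
    and edge: "e \<in> E \<Longrightarrow> e \<subseteq> V \<and> card e = 2"
    and edge_verts: "e \<in> E \<Longrightarrow> convex hull e \<inter> V \<subseteq> e"
    and edge_edge: "e \<in> E \<Longrightarrow> e' \<in> E \<Longrightarrow> e \<noteq> e' \<Longrightarrow> convex hull e \<inter> convex hull e' \<subseteq> e \<inter> e'"
    and face: "f \<in> F \<Longrightarrow> f \<subseteq> V \<and> is_tri f"
    and face_verts: "f \<in> F \<Longrightarrow> open_tri f \<inter> V = {}"
    and face_edge: "f \<in> F \<Longrightarrow> e \<in> E \<Longrightarrow> open_tri f \<inter> convex hull e = {}"
    and face_face: "f \<in> F \<Longrightarrow> f' \<in> F \<Longrightarrow> f \<noteq> f' \<Longrightarrow> open_tri f \<inter> open_tri f' = {}"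
    and edge_in_face: "e \<in> E \<Longrightarrow> \<exists>f\<in>F. e \<subseteq> f"

section \<open>Plane graphs built from one triangle by stacking vertices into faces\<close>

lemma tri_exists: "\<exists>a b c :: real^2. tri a b c"
proof -
  have "tri 0 (axis 1 1) (axis 2 1 :: real^2)"
    unfolding tri_def by (auto simp: vec_eq_iff forall_2 axis_def)
  then show ?thesis by blast
qed

lemma plane_graph_triangle:
  assumes t: "tri a b c"
  shows "plane_graph {a,b,c} {{a,b},{a,c},{b,c}} {{a,b,c}}"
proof -
  have p: "tri b a c" "tri a c b" "tri b c a" "tri c a b" "tri c b a"
    using t tri_perm by metis+
  have d: "a \<noteq> b" "a \<noteq> c" "b \<noteq> c" using tri_distinct[OF t] .
  have i: "convex hull {a,b} \<inter> convex hull {a,c} \<subseteq> {a}"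
       "convex hull {a,b} \<inter> convex hull {b,c} \<subseteq> {b}"
       "convex hull {a,c} \<inter> convex hull {b,c} \<subseteq> {c}"
    using hull_side_Int[OF t] hull_side_Int[OF p(1)] hull_side_Int[OF p(4)]
    by (simp_all add: insert_commute)
  have o: "open_tri {a,b,c} \<inter> convex hull {a,b} = {}" "open_tri {a,b,c} \<inter> convex hull {a,c} = {}"
      "open_tri {a,b,c} \<inter> convex hull {b,c} = {}"
    using open_tri_hull_side_disjoint[OF t] open_tri_hull_side_disjoint[OF p(2)]
      open_tri_hull_side_disjoint[OF p(3)] by (simp_all add: insert_commute)
  have m: "a \<in> convex hull {a,b}" "b \<in> convex hull {a,b}" "a \<in> convex hull {a,c}"
      "c \<in> convex hull {a,c}" "b \<in> convex hull {b,c}" "c \<in> convex hull {b,c}"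
    by (auto intro: hull_inc)
  have n: "a \<notin> convex hull {b,c}" "b \<notin> convex hull {a,c}" "c \<notin> convex hull {a,b}"
    using i m d by blast+
  have h2: "convex hull {a,b} \<inter> {a,b,c} \<subseteq> {a,b}" "convex hull {a,c} \<inter> {a,b,c} \<subseteq> {a,c}"
     "convex hull {b,c} \<inter> {a,b,c} \<subseteq> {b,c}" using n by auto
  have h3: "\<forall>e\<in>{{a,b},{a,c},{b,c}}. \<forall>e'\<in>{{a,b},{a,c},{b,c}}. e \<noteq> e' \<longrightarrow> convex hull e \<inter> convex hull e' \<subseteq> e \<inter> e'"
    using i by blast
  have h4: "open_tri {a,b,c} \<inter> {a,b,c} = {}" using o m by blast
  show ?thesis
  proof
    fix e e' f f' assume e: "e \<in> {{a,b},{a,c},{b,c}}" 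
    show "e \<subseteq> {a,b,c} \<and> card e = 2" using e d by auto
    show "convex hull e \<inter> {a,b,c} \<subseteq> e" using e h2 by blast
    show "\<exists>f\<in>{{a,b,c}}. e \<subseteq> f" using e by blast
    show "convex hull e \<inter> convex hull e' \<subseteq> e \<inter> e'" if "e' \<in> {{a,b},{a,c},{b,c}}" "e \<noteq> e'"
      by (rule h3[rule_format, OF e that])
    show "open_tri f \<inter> convex hull e = {}" if "f \<in> {{a,b,c}}" using that e o by blast
  next
    fix f assume f: "f \<in> {{a,b,c}}"
    show "f \<subseteq> {a,b,c} \<and> is_tri f" using f is_triI[OF t] by blast
    show "open_tri f \<inter> {a,b,c} = {}" using f h4 by blast
  qed auto
qed

text \<open>Everything new stays in the old open face apart from the corners \<open>a\<close>,
  \<open>b\<close>, \<open>c\<close>, and that face met no vertex, edge or other listed face. Only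
  collisions among the new spokes and triangles need barycentric coordinates.\<close>

lemma plane_graph_insert:
  assumes P: "plane_graph V E F" and f: "{a,b,c} \<in> F" and t: "tri a b c" and d: "d = centroid3 a b c"
  shows "d \<notin> V"
    "plane_graph (insert d V) (E \<union> {{d,a},{d,b},{d,c}}) (F - {{a,b,c}} \<union> {{a,b,d},{a,c,d},{b,c,d}})"
proof -
  let ?f = "{a,b,c}"
  let ?N = "{{d,a},{d,b},{d,c}}" and ?G = "{{a,b,d},{a,c,d},{b,c,d}}"
  have p: "tri b a c" "tri a c b" "tri b c a" "tri c a b" "tri c b a"
    using t tri_perm by metis+
  have cd: "centroid3 a b c = d" "centroid3 a c b = d" "centroid3 b c a = d" "centroid3 b a c = d"
     "centroid3 c a b = d" "centroid3 c b a = d"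
    unfolding d by (metis centroid3_perm)+
  interpret plane_graph V E F by (fact P)
  have fV: "a \<in> V" "b \<in> V" "c \<in> V" using face[OF f] by auto
  have dO: "d \<in> open_tri ?f" unfolding open_tri_iff[OF t]
    by (intro exI[of _ "1/3"]) (simp add: d centroid3_def scaleR_right_distrib)
  show dV: "d \<notin> V" using dO face_verts[OF f] by blast
  have dn: "d \<noteq> a" "d \<noteq> b" "d \<noteq> c" using dV fV by auto
  have hs: "convex hull {d,y} \<subseteq> insert y (open_tri ?f)" if "y \<in> ?f" for y
    using that hull_centroid3_subset[OF t] hull_centroid3_subset[OF p(1)] hull_centroid3_subset[OF p(4)]
    by (auto simp: cd insert_commute)
  have os: "open_tri g \<subseteq> open_tri ?f" if "g \<in> ?G" for g
  proof -
    have "open_tri {a,b,d} \<subseteq> open_tri ?f" using open_tri_centroid3_subset[OF t] by (simp add: cd)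
    moreover have "open_tri {a,c,d} \<subseteq> open_tri ?f" using open_tri_centroid3_subset[OF p(2)] by (simp add: cd insert_commute)
    moreover have "open_tri {b,c,d} \<subseteq> open_tri ?f" using open_tri_centroid3_subset[OF p(3)] by (simp add: cd insert_commute)
    ultimately show ?thesis using that by blast
  qed
  have oh: "open_tri g \<inter> convex hull {d,y} = {}" if "g \<in> ?G" "y \<in> ?f" for g y
  proof -
    have y: "y \<in> {a,b,c}" "y \<in> {a,c,b}" "y \<in> {b,c,a}" using that(2) by auto
    have "open_tri {a,b,d} \<inter> convex hull {d,y} = {}" "open_tri {a,c,d} \<inter> convex hull {d,y} = {}"
      "open_tri {b,c,d} \<inter> convex hull {d,y} = {}"
      using open_tri_hull_centroid3_disjoint[OF t y(1)] open_tri_hull_centroid3_disjoint[OF p(2) y(2)]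
        open_tri_hull_centroid3_disjoint[OF p(3) y(3)] unfolding cd by simp_all
    then show ?thesis using that(1) by blast
  qed
  have oo: "open_tri g \<inter> open_tri g' = {}" if "g \<in> ?G" "g' \<in> ?G" "g \<noteq> g'" for g g'
  proof -
    have "open_tri {a,b,d} \<inter> open_tri {a,c,d} = {}" using open_tri_centroid3_disjoint[OF t] by (simp add: cd)
    moreover have "open_tri {a,b,d} \<inter> open_tri {b,c,d} = {}"
      using open_tri_centroid3_disjoint[OF p(1)] by (simp add: cd insert_commute)
    moreover have "open_tri {a,c,d} \<inter> open_tri {b,c,d} = {}"
      using open_tri_centroid3_disjoint[OF p(4)] by (simp add: cd insert_commute)
    ultimately show ?thesis using that by blast
  qed
  have hh: "convex hull {d,y} \<inter> convex hull {d,z} \<subseteq> {d}" if "y \<in> ?f" "z \<in> ?f" "y \<noteq> z" for y z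
  proof -
    have "convex hull {d,a} \<inter> convex hull {d,b} \<subseteq> {d}" using hull_centroid3_Int[OF t] by (simp add: cd)
    moreover have "convex hull {d,a} \<inter> convex hull {d,c} \<subseteq> {d}" using hull_centroid3_Int[OF p(2)] by (simp add: cd)
    moreover have "convex hull {d,b} \<inter> convex hull {d,c} \<subseteq> {d}" using hull_centroid3_Int[OF p(3)] by (simp add: cd)
    ultimately show ?thesis using that by blast
  qed
  have newE: "\<exists>y\<in>?f. e = {d,y}" if "e \<in> ?N" for e using that by blast
  \<comment> \<open>An old edge misses the open face, so it can meet a spoke only at the corner
    \<open>y\<close>; as \<open>y\<close> is a vertex, it is then an end of
    \<open>e\<close>.\<close>
  have on: "convex hull e \<inter> convex hull {d,y} \<subseteq> e \<inter> {d,y}" if "e \<in> E" "y \<in> ?f" for e y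
  proof -
    have "y \<in> V" using that(2) fV by auto
    then show ?thesis using hs[OF that(2)] face_edge[OF f that(1)] edge_verts[OF that(1)] by blast
  qed
  have c2: "\<forall>e\<in>E \<union> ?N. e \<subseteq> insert d V \<and> card e = 2" using edge fV dn by auto
  have c3: "\<forall>e\<in>E \<union> ?N. convex hull e \<inter> insert d V \<subseteq> e"
  proof
    fix e assume "e \<in> E \<union> ?N"
    then consider "e \<in> E" | y where "y \<in> ?f" "e = {d,y}" using newE by blast
    then show "convex hull e \<inter> insert d V \<subseteq> e"
    proof cases
      case 1 then show ?thesis using edge_verts[OF 1] face_edge[OF f 1] dO by blast
    next
      case 2 then show ?thesis using hs[OF 2(1)] face_verts[OF f] by blast
    qed
  qed
  have c4: "\<forall>e\<in>E \<union> ?N. \<forall>e'\<in>E \<union> ?N. e \<noteq> e' \<longrightarrow> convex hull e \<inter> convex hull e' \<subseteq> e \<inter> e'"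
  proof (intro ballI impI)
    fix e e' assume e: "e \<in> E \<union> ?N" and e': "e' \<in> E \<union> ?N" and ne: "e \<noteq> e'"
    from e consider "e \<in> E" | y where "y \<in> ?f" "e = {d,y}" using newE by blast
    then show "convex hull e \<inter> convex hull e' \<subseteq> e \<inter> e'"
    proof cases
      case 1
      from e' consider "e' \<in> E" | z where "z \<in> ?f" "e' = {d,z}" using newE by blast
      then show ?thesis
      proof cases
        case 1 then show ?thesis using \<open>e \<in> E\<close> edge_edge ne by blast
      next
        case 2 then show ?thesis using on[OF 1 2(1)] by simp
      qed
    next
      case 2
      from e' consider "e' \<in> E" | z where "z \<in> ?f" "e' = {d,z}" using newE by blast
      then show ?thesis
      proof cases
        case 1 then show ?thesis using on[OF 1 2(1)] 2 by blast
      next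
        case B: 2
        then have "y \<noteq> z" using 2 ne by blast
        then show ?thesis using hh[OF 2(1) B(1)] 2(2) B(2) by blast
      qed
    qed
  qed
  have c5: "\<forall>g\<in>F - {?f} \<union> ?G. g \<subseteq> insert d V \<and> is_tri g"
  proof -
    have "tri a b d" "tri a c d" "tri b c d" 
      using tri_centroid3[OF t] tri_centroid3[OF p(2)] tri_centroid3[OF p(3)] by (simp_all add: cd)
    then have "is_tri {a,b,d}" "is_tri {a,c,d}" "is_tri {b,c,d}" by (simp_all add: is_triI)
    then show ?thesis using face fV by blast
  qed
  \<comment> \<open>Each face of the new list lies inside an old one, so its disjointness from old
    vertices and edges is inherited.\<close>
  have sub: "\<exists>h\<in>F. open_tri g \<subseteq> open_tri h" if "g \<in> F - {?f} \<union> ?G" for g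
  proof (cases "g \<in> ?G")
    case True then show ?thesis using os f by blast
  next
    case False then show ?thesis using that by blast
  qed
  have c7: "\<forall>g\<in>F - {?f} \<union> ?G. \<forall>e\<in>E \<union> ?N. open_tri g \<inter> convex hull e = {}"
  proof (intro ballI)
    fix g e assume g: "g \<in> F - {?f} \<union> ?G" and e: "e \<in> E \<union> ?N"
    from e consider "e \<in> E" | y where "y \<in> ?f" "e = {d,y}" using newE by blast
    then show "open_tri g \<inter> convex hull e = {}"
    proof cases
      case 1
      obtain h where "h \<in> F" "open_tri g \<subseteq> open_tri h" using sub[OF g] by blast
      then show ?thesis using face_edge[OF _ 1, of h] by blast
    next
      case 2
      show ?thesis
      proof (cases "g \<in> ?G")
        case True then show ?thesis using oh[OF True 2(1)] 2(2) by simp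
      next
        case False
        then have "g \<in> F" "g \<noteq> ?f" using g by auto
        moreover have "y \<in> V" using 2(1) fV by auto
        \<comment> \<open>Off \<open>y\<close> the spoke lies in the open face that was cut, which
          is disjoint from \<open>open_tri g\<close>; and \<open>y\<close> itself is a
          vertex.\<close>
        ultimately show ?thesis using hs[OF 2(1)] 2(2) face_face[OF _ f, of g] face_verts[of g] by blast
      qed
    qed
  qed
  have c6: "\<forall>g\<in>F - {?f} \<union> ?G. open_tri g \<inter> insert d V = {}"
  proof
    fix g assume g: "g \<in> F - {?f} \<union> ?G"
    \<comment> \<open>The new vertex lies on a spoke, so the statement on edges, \<open>c7\<close>,
      already keeps it out of every listed open triangle.\<close>
    have "d \<in> convex hull {d,a}" by (simp add: hull_inc)
    then have "d \<notin> open_tri g" using c7 g by blast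
    moreover obtain h where "h \<in> F" "open_tri g \<subseteq> open_tri h" using sub[OF g] by blast
    then have "open_tri g \<inter> V = {}" using face_verts[of h] by blast
    ultimately show "open_tri g \<inter> insert d V = {}" by blast
  qed
  have c8: "\<forall>g\<in>F - {?f} \<union> ?G. \<forall>g'\<in>F - {?f} \<union> ?G. g \<noteq> g' \<longrightarrow> open_tri g \<inter> open_tri g' = {}"
  proof (intro ballI impI)
    fix g g' assume g: "g \<in> F - {?f} \<union> ?G" and g': "g' \<in> F - {?f} \<union> ?G" and ne: "g \<noteq> g'"
    show "open_tri g \<inter> open_tri g' = {}"
    proof (cases "g \<in> ?G")
      case True
      show ?thesis
      proof (cases "g' \<in> ?G")
        case True
        then show ?thesis using oo[OF \<open>g \<in> ?G\<close> True ne] by simp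
      next
        case False
        then have "g' \<in> F" "g' \<noteq> ?f" using g' by auto
        then show ?thesis using os[OF \<open>g \<in> ?G\<close>] face_face[OF _ f, of g'] by blast
      qed
    next
      case False
      then have gF: "g \<in> F" "g \<noteq> ?f" using g by auto
      show ?thesis
      proof (cases "g' \<in> ?G")
        case True
        then show ?thesis using os[OF True] face_face[OF gF(1) f gF(2)] by blast
      next
        case False
        then have "g' \<in> F" using g' by auto
        then show ?thesis using face_face[OF gF(1) _ ne] by simp
      qed
    qed
  qed
  have c9: "\<forall>e\<in>E \<union> ?N. \<exists>g\<in>F - {?f} \<union> ?G. e \<subseteq> g"
  proof
    fix e assume "e \<in> E \<union> ?N"
    then consider "e \<in> E" | y where "y \<in> ?f" "e = {d,y}" using newE by blast
    then show "\<exists>g\<in>F - {?f} \<union> ?G. e \<subseteq> g"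
    proof cases
      case 1
      obtain g where g: "g \<in> F" "e \<subseteq> g" using edge_in_face[OF 1] by blast
      show ?thesis
      proof (cases "g = ?f")
        \<comment> \<open>The face beside \<open>e\<close> was cut up, but any two of its corners
          lie together in one of the new triangles.\<close>
        case True
        obtain y z where yz: "e = {y,z}" "y \<noteq> z" using edge[OF 1] by (auto simp: card_2_iff)
        then have "y \<in> ?f" "z \<in> ?f" using g(2) True by simp_all
        then have "e \<subseteq> {a,b,d} \<or> e \<subseteq> {a,c,d} \<or> e \<subseteq> {b,c,d}" using yz by auto
        then show ?thesis by (elim disjE) simp_all
      next
        case False then show ?thesis using g by (intro bexI[of _ g]) simp_all
      qed
    next
      case 2 then show ?thesis by auto
    qed
  qed
  show "plane_graph (insert d V) (E \<union> ?N) (F - {?f} \<union> ?G)"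
  proof (rule plane_graph.intro)
    show "finite (insert d V)" using finite_V by simp
  qed (fact c2[rule_format] c3[rule_format] c4[rule_format] c5[rule_format] c6[rule_format]
    c7[rule_format] c8[rule_format] c9[rule_format])+
qed

section \<open>From straight-line drawings to topological planarity\<close>

text \<open>The inverse of \<open>i\<close> places the renamed vertices back at their points, and
  the arcs are line segments. Renaming lets a drawn graph be read as a graph on natural
  numbers.\<close>

lemma planar_transfer:
  fixes V :: "(real^2) set" and i :: "real^2 \<Rightarrow> 'a"
  assumes P: "plane_graph V E F" and i: "inj_on i V"
  shows "planar (i ` V) ((`) i ` E)"
proof -
  define p where "p = the_inv_into V i"
  have pi: "p (i x) = x" if "x \<in> V" for x using that the_inv_into_f_f[OF i] by (simp add: p_def)
  have pe: "p ` i ` e = e" if "e \<subseteq> V" for e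
    using that pi by (force simp: image_image)
  interpret plane_graph V E F by (fact P)
  have "\<forall>e\<in>E. \<exists>g. arc g \<and> {pathstart g, pathfinish g} = e \<and> path_image g = convex hull e"
  proof
    fix e assume "e \<in> E"
    then obtain a b where "e = {a,b}" "a \<noteq> b" using edge by (meson card_2_iff)
    then show "\<exists>g. arc g \<and> {pathstart g, pathfinish g} = e \<and> path_image g = convex hull e"
      by (intro exI[of _ "linepath a b"]) (auto simp: segment_convex_hull)
  qed
  then obtain g where g: "\<And>e. e \<in> E \<Longrightarrow> arc (g e) \<and> {pathstart (g e), pathfinish (g e)} = e
      \<and> path_image (g e) = convex hull e" by metis
  have pV: "p ` i ` V = V" using pe by simp
  show ?thesis unfolding planar_def
  proof (rule exI[of _ p], rule exI[of _ "\<lambda>e. g (p ` e)"], intro conjI ballI impI)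
    show "inj_on p (i ` V)" using pi by (auto simp: inj_on_def)
  next
    fix e' assume "e' \<in> (`) i ` E"
    then obtain e where e: "e \<in> E" "e' = i ` e" by blast
    then have pe': "p ` e' = e" using pe edge by blast
    show "arc (g (p ` e'))" "{pathstart (g (p ` e')), pathfinish (g (p ` e'))} = p ` e'"
      unfolding pe' using g[OF e(1)] by auto
    have "e \<subseteq> convex hull e" by (rule hull_subset)
    then show "path_image (g (p ` e')) \<inter> p ` i ` V = p ` e'"
      unfolding pe' pV using g[OF e(1)] edge_verts[OF e(1)] edge[OF e(1)] by auto
  next
    fix e1 e2 assume h: "e1 \<in> (`) i ` E" "e2 \<in> (`) i ` E" "e1 \<noteq> e2"
    then obtain e e' where e: "e \<in> E" "e1 = i ` e" "e' \<in> E" "e2 = i ` e'" by blast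
    have ee: "e \<noteq> e'" using h e by blast
    have "e \<inter> e' \<subseteq> p ` (e1 \<inter> e2)" 
    proof
      fix x assume x: "x \<in> e \<inter> e'"
      then have "i x \<in> e1 \<inter> e2" "x \<in> V" using e edge by auto
      then show "x \<in> p ` (e1 \<inter> e2)" using pi by (metis imageI)
    qed
    moreover have "p ` e1 = e" "p ` e2 = e'" using e pe edge by blast+
    ultimately show "path_image (g (p ` e1)) \<inter> path_image (g (p ` e2)) \<subseteq> p ` (e1 \<inter> e2)"
      using edge_edge[OF e(1,3) ee] g e by auto
  qed
qed

section \<open>Alternating paths on every edge\<close>

text \<open>Gadgets built in one round must survive all later stacking, so edges once drawn keep
  their signs.\<close>

definition signed_ext :: "'p set set \<Rightarrow> 'p set set \<Rightarrow> 'p set set \<Rightarrow> 'p set set \<Rightarrow> bool" where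
  "signed_ext E N E' N' \<longleftrightarrow> E \<subseteq> E' \<and> N' \<inter> E = N"

text \<open>Each of the two stretches of five vertices forces four distinct images in
  \<open>H\<close>, and \<open>4 + 4\<close> is the number of vertices of \<open>H\<close> other
  than the images of \<open>u\<close> and \<open>v\<close>. The signs at \<open>v\<close> tell the
  stretches apart.\<close>

definition has_gadget :: "'p set set \<Rightarrow> 'p set set \<Rightarrow> 'p \<Rightarrow> 'p \<Rightarrow> bool" where
  "has_gadget E N u v \<longleftrightarrow> (\<exists>p :: nat \<Rightarrow> 'p.
     (\<forall>i<10. {u, p i} \<in> E \<and> {u, p i} \<notin> N \<and> {v, p i} \<in> E \<and> ({v, p i} \<in> N \<longleftrightarrow> 5 \<le> i)) \<and>
     (\<forall>i<9. {p i, p (Suc i)} \<in> E \<and> ({p i, p (Suc i)} \<in> N \<longleftrightarrow> odd i)))"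

definition signed_plane :: "'p::real_vector set \<Rightarrow> 'p set set \<Rightarrow> 'p set set \<Rightarrow> 'p set set \<Rightarrow> bool" where
  "signed_plane V E N F \<longleftrightarrow> plane_graph V E F \<and> N \<subseteq> E"

lemma signed_ext_refl: "N \<subseteq> E \<Longrightarrow> signed_ext E N E N"
  unfolding signed_ext_def by blast

lemma signed_ext_trans:
  "signed_ext E N E' N' \<Longrightarrow> signed_ext E' N' E'' N'' \<Longrightarrow> signed_ext E N E'' N''"
  unfolding signed_ext_def by blast

lemma signed_ext_edge:
  "signed_ext E N E' N' \<Longrightarrow> e \<in> E \<Longrightarrow> e \<in> E' \<and> (e \<in> N' \<longleftrightarrow> e \<in> N)"
  unfolding signed_ext_def by blast

lemma has_gadget_cong:
  assumes "has_gadget E N u v" "\<And>e. e \<in> E \<Longrightarrow> e \<in> E' \<and> (e \<in> N' \<longleftrightarrow> e \<in> N)"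
  shows "has_gadget E' N' u v"
proof -
  obtain p :: "nat \<Rightarrow> 'a" where
    p: "\<And>i. i < 10 \<Longrightarrow> {u, p i} \<in> E \<and> {u, p i} \<notin> N \<and> {v, p i} \<in> E \<and> ({v, p i} \<in> N \<longleftrightarrow> 5 \<le> i)"
      "\<And>i. i < 9 \<Longrightarrow> {p i, p (Suc i)} \<in> E \<and> ({p i, p (Suc i)} \<in> N \<longleftrightarrow> odd i)"
    using assms(1) unfolding has_gadget_def by blast
  show ?thesis unfolding has_gadget_def by (rule exI[of _ p]) (simp add: p assms(2))
qed

text \<open>The locale gives a face whose corners come in arbitrary order; the six cases put
  \<open>u\<close> and \<open>v\<close> first.\<close>

lemma face_of_edge:
  assumes "plane_graph V E F" "{u,v} \<in> E"
  obtains z where "{u,v,z} \<in> F" "tri u v z"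
proof -
  interpret plane_graph V E F by fact
  obtain f where f: "f \<in> F" "{u,v} \<subseteq> f" using edge_in_face[OF assms(2)] by blast
  obtain a b c where t: "f = {a,b,c}" "tri a b c" using face[OF f(1)] unfolding is_tri_def by blast
  have p: "tri b a c" "tri a c b" "tri b c a" "tri c a b" "tri c b a"
    using t(2) tri_perm by metis+
  have "u \<noteq> v" using edge[OF assms(2)] by auto
  moreover have "u \<in> {a,b,c}" "v \<in> {a,b,c}" using f t(1) by auto
  ultimately have "(u = a \<and> v = b) \<or> (u = a \<and> v = c) \<or> (u = b \<and> v = a) \<or> (u = b \<and> v = c) \<or>
      (u = c \<and> v = a) \<or> (u = c \<and> v = b)" by auto
  moreover have "f = {a,c,b}" "f = {b,a,c}" "f = {b,c,a}" "f = {c,a,b}" "f = {c,b,a}"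
    using t(1) by auto
  ultimately have "(\<exists>z. f = {u,v,z} \<and> tri u v z)"
    using t p by metis
  then show thesis using that f(1) by blast
qed

text \<open>The spokes at the new vertex are new edges, so their signs can be prescribed. Since
  \<open>{u,v,d}\<close> is again a listed face, the step can be repeated on the same edge
  \<open>uv\<close>.\<close>

lemma stack_vertex:
  assumes S: "signed_plane V E N F" and f: "{u,v,z} \<in> F" and t: "tri u v z"
  obtains V' E' N' F' d where "signed_plane V' E' N' F'" "signed_ext E N E' N'"
    "{u,v,d} \<in> F'" "tri u v d"
    "{u,d} \<in> E'" "{u,d} \<in> N' \<longleftrightarrow> su" "{v,d} \<in> E'" "{v,d} \<in> N' \<longleftrightarrow> sv" "{z,d} \<in> E'" "{z,d} \<in> N' \<longleftrightarrow> sz"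
proof -
  define d where "d = centroid3 u v z"
  have P: "plane_graph V E F" and NE: "N \<subseteq> E" using S by (auto simp: signed_plane_def)
  interpret plane_graph V E F by fact
  let ?V = "insert d V" and ?E = "E \<union> {{d,u},{d,v},{d,z}}"
    and ?F = "F - {{u,v,z}} \<union> {{u,v,d},{u,z,d},{v,z,d}}"
  let ?N = "N \<union> (if su then {{d,u}} else {}) \<union> (if sv then {{d,v}} else {}) \<union> (if sz then {{d,z}} else {})"
  note ins = plane_graph_insert[OF P f t d_def]
  have nE: "{x,d} \<notin> E" "{d,x} \<notin> E" for x using edge[of "{x,d}"] ins(1) by (auto simp: insert_commute)
  have nN: "{x,d} \<notin> N" "{d,x} \<notin> N" for x using nE NE by blast+
  have ds: "u \<noteq> v" "u \<noteq> z" "v \<noteq> z" using tri_distinct[OF t] .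
  show thesis
  proof (rule that)
    show "signed_plane ?V ?E ?N ?F" using ins(2) NE unfolding signed_plane_def by auto
    show "signed_ext E N ?E ?N" unfolding signed_ext_def using NE nE by auto
    show "{u,v,d} \<in> ?F" by simp
    show "tri u v d" using tri_centroid3[OF t] d_def by simp
    show "{u,d} \<in> ?E" "{v,d} \<in> ?E" "{z,d} \<in> ?E" by (simp_all add: insert_commute)
    show "{u,d} \<in> ?N \<longleftrightarrow> su" "{v,d} \<in> ?N \<longleftrightarrow> sv" "{z,d} \<in> ?N \<longleftrightarrow> sz"
      using ds nN by (auto simp: doubleton_eq_iff)
  qed
qed

text \<open>The invariant is a listed face on \<open>uv\<close> whose third corner is the last path
  vertex: the next vertex, stacked into it, is adjacent to \<open>u\<close>, \<open>v\<close> and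
  its predecessor.\<close>

lemma stack_path:
  assumes S: "signed_plane V E N F" and e: "{u,v} \<in> E"
  shows "\<exists>V' E' N' F' p z. signed_plane V' E' N' F' \<and> signed_ext E N E' N' \<and>
    {u,v,z} \<in> F' \<and> tri u v z \<and> (\<forall>i. Suc i = k \<longrightarrow> z = p i) \<and>
    (\<forall>i<k. {u, p i} \<in> E' \<and> {u, p i} \<notin> N' \<and> {v, p i} \<in> E' \<and> ({v, p i} \<in> N' \<longleftrightarrow> 5 \<le> i)) \<and>
    (\<forall>i. Suc i < k \<longrightarrow> {p i, p (Suc i)} \<in> E' \<and> ({p i, p (Suc i)} \<in> N' \<longleftrightarrow> odd i))"
proof (induction k)
  case 0
  obtain z where "{u,v,z} \<in> F" "tri u v z"
    using face_of_edge e S unfolding signed_plane_def by metis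
  moreover have "signed_ext E N E N" using S by (simp add: signed_plane_def signed_ext_refl)
  ultimately show ?case using S by blast
next
  case (Suc k)
  then obtain V1 E1 N1 F1 p z where I: "signed_plane V1 E1 N1 F1" "signed_ext E N E1 N1"
    "{u,v,z} \<in> F1" "tri u v z" "\<forall>i. Suc i = k \<longrightarrow> z = p i"
    and I1: "\<And>i. i < k \<Longrightarrow> {u, p i} \<in> E1 \<and> {u, p i} \<notin> N1 \<and> {v, p i} \<in> E1 \<and> ({v, p i} \<in> N1 \<longleftrightarrow> 5 \<le> i)"
    and I2: "\<And>i. Suc i < k \<Longrightarrow> {p i, p (Suc i)} \<in> E1 \<and> ({p i, p (Suc i)} \<in> N1 \<longleftrightarrow> odd i)"
    by blast
  \<comment> \<open>The spoke \<open>zd\<close> is the path edge with index \<open>k - 1\<close>.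
    For \<open>k = 0\<close> the corner \<open>z\<close> is not on the path, and the truncated
    subtraction merely fixes some sign.\<close>
  obtain V' E' N' F' d where J: "signed_plane V' E' N' F'" "signed_ext E1 N1 E' N'"
    "{u,v,d} \<in> F'" "tri u v d"
    "{u,d} \<in> E'" "{u,d} \<in> N' \<longleftrightarrow> False" "{v,d} \<in> E'" "{v,d} \<in> N' \<longleftrightarrow> 5 \<le> k"
    "{z,d} \<in> E'" "{z,d} \<in> N' \<longleftrightarrow> odd (k - 1)"
    by (rule stack_vertex[OF I(1,3,4), where su = False and sv = "5 \<le> k" and sz = "odd (k - 1)"])
  let ?p = "p(k := d)"
  note mono = signed_ext_edge[OF J(2)]
  have "\<forall>i<Suc k. {u, ?p i} \<in> E' \<and> {u, ?p i} \<notin> N' \<and> {v, ?p i} \<in> E' \<and> ({v, ?p i} \<in> N' \<longleftrightarrow> 5 \<le> i)"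
  proof (intro allI impI)
    fix i assume "i < Suc k"
    then consider "i = k" | "i < k" by linarith
    then show "{u, ?p i} \<in> E' \<and> {u, ?p i} \<notin> N' \<and> {v, ?p i} \<in> E' \<and> ({v, ?p i} \<in> N' \<longleftrightarrow> 5 \<le> i)"
    proof cases
      case 1 then show ?thesis using J by simp
    next
      case 2 then show ?thesis using I1[OF 2] mono by simp
    qed
  qed
  moreover have "\<forall>i. Suc i < Suc k \<longrightarrow> {?p i, ?p (Suc i)} \<in> E' \<and> ({?p i, ?p (Suc i)} \<in> N' \<longleftrightarrow> odd i)"
  proof (intro allI impI)
    fix i assume "Suc i < Suc k"
    then consider "Suc i = k" | "Suc i < k" by linarith
    then show "{?p i, ?p (Suc i)} \<in> E' \<and> ({?p i, ?p (Suc i)} \<in> N' \<longleftrightarrow> odd i)"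
    proof cases
      case 1
      then have "z = p i" using I(5) by blast
      then show ?thesis using J(9,10) 1 by auto
    next
      case 2 then show ?thesis using I2[OF 2] mono by simp
    qed
  qed
  moreover have "\<forall>i. Suc i = Suc k \<longrightarrow> d = ?p i" by simp
  moreover have "signed_ext E N E' N'" using I(2) J(2) signed_ext_trans by blast
  ultimately show ?case using J(1,3,4) by blast
qed

lemma insert_gadget:
  assumes "signed_plane V E N F" and "{u,v} \<in> E"
  obtains V' E' N' F' where "signed_plane V' E' N' F'" "signed_ext E N E' N'" "has_gadget E' N' u v"
proof -
  obtain V' E' N' F' p where *: "signed_plane V' E' N' F'" "signed_ext E N E' N'"
    "\<forall>i<10. {u, p i} \<in> E' \<and> {u, p i} \<notin> N' \<and> {v, p i} \<in> E' \<and> ({v, p i} \<in> N' \<longleftrightarrow> 5 \<le> i)"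
    "\<forall>i. Suc i < 10 \<longrightarrow> {p i, p (Suc i)} \<in> E' \<and> ({p i, p (Suc i)} \<in> N' \<longleftrightarrow> odd i)"
    using stack_path[OF assms, of 10] by blast
  have "has_gadget E' N' u v" unfolding has_gadget_def
    by (rule exI[of _ p]) (use *(3,4) in auto)
  then show thesis using that * by blast
qed

text \<open>Ordered pairs, because \<open>u\<close> and \<open>v\<close> play different roles in a
  gadget. Finished gadgets, and the edges still to be treated, survive each stacking.\<close>

lemma insert_gadgets:
  assumes "finite D" "signed_plane V E N F" "\<And>u v. (u,v) \<in> D \<Longrightarrow> {u,v} \<in> E"
  shows "\<exists>V' E' N' F'. signed_plane V' E' N' F' \<and> signed_ext E N E' N' \<and> (\<forall>(u,v)\<in>D. has_gadget E' N' u v)"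
  using assms(1,3)
proof (induction D rule: finite_induct)
  case empty
  have "signed_ext E N E N" using assms(2) by (simp add: signed_plane_def signed_ext_refl)
  then show ?case using assms(2) by blast
next
  case (insert x D)
  then obtain V1 E1 N1 F1 where I: "signed_plane V1 E1 N1 F1" "signed_ext E N E1 N1"
      "\<forall>(u,v)\<in>D. has_gadget E1 N1 u v" by blast
  obtain a b where x: "x = (a,b)" by (cases x)
  then have "{a,b} \<in> E1" using insert.prems signed_ext_edge[OF I(2)] by blast
  then obtain V' E' N' F' where J: "signed_plane V' E' N' F'" "signed_ext E1 N1 E' N'" "has_gadget E' N' a b"
    using insert_gadget[OF I(1)] by blast
  have "\<forall>(u,v)\<in>insert x D. has_gadget E' N' u v"
    using J(3) x I(3) has_gadget_cong[OF _ signed_ext_edge[OF J(2)]] by blast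
  then show ?case using J(1) signed_ext_trans[OF I(2) J(2)] by blast
qed

lemma gadget_on_every_edge:
  assumes "signed_plane V E N F"
  obtains V' E' N' F' where "signed_plane V' E' N' F'" "signed_ext E N E' N'"
    "\<And>u v. {u,v} \<in> E \<Longrightarrow> has_gadget E' N' u v"
proof -
  interpret plane_graph V E F using assms by (simp add: signed_plane_def)
  have "{(u,v). {u,v} \<in> E} \<subseteq> V \<times> V" using edge by blast
  then have "finite {(u,v). {u,v} \<in> E}" using finite_V finite_subset by blast
  from insert_gadgets[OF this assms] show thesis using that by auto
qed

text \<open>Under a homomorphism to \<open>AT(H)\<close>, round one makes every vertex of
  \<open>H\<close> the image of an end of an edge in \<open>E1\<close>; round two pairs it, along
  edges in \<open>E2\<close>, with every other vertex; round three puts a gadget on each such edge,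
  to count signs there.\<close>

lemma three_rounds:
  obtains V :: "(real^2) set" and E N F E0 E1 E2 u v where "plane_graph V E F" "N \<subseteq> E"
    "{u,v} \<in> E0" "E0 \<subseteq> E1" "E1 \<subseteq> E2" "E2 \<subseteq> E"
    "\<And>u v. {u,v} \<in> E0 \<Longrightarrow> has_gadget E1 N u v"
    "\<And>u v. {u,v} \<in> E1 \<Longrightarrow> has_gadget E2 N u v"
    "\<And>u v. {u,v} \<in> E2 \<Longrightarrow> has_gadget E N u v"
proof -
  obtain a b c :: "real^2" where "tri a b c" using tri_exists by blast
  then have S0: "signed_plane {a,b,c} {{a,b},{a,c},{b,c}} {} {{a,b,c}}"
    by (simp add: signed_plane_def plane_graph_triangle)
  define E0 where "E0 = {{a,b},{a,c},{b,c}}"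
  obtain V1 E1 N1 F1 where 1: "signed_plane V1 E1 N1 F1" "signed_ext E0 {} E1 N1"
    "\<And>u v. {u,v} \<in> E0 \<Longrightarrow> has_gadget E1 N1 u v"
    using gadget_on_every_edge[OF S0[folded E0_def]] by metis
  obtain V2 E2 N2 F2 where 2: "signed_plane V2 E2 N2 F2" "signed_ext E1 N1 E2 N2"
    "\<And>u v. {u,v} \<in> E1 \<Longrightarrow> has_gadget E2 N2 u v"
    using gadget_on_every_edge[OF 1(1)] by metis
  obtain V E N F where 3: "signed_plane V E N F" "signed_ext E2 N2 E N"
    "\<And>u v. {u,v} \<in> E2 \<Longrightarrow> has_gadget E N u v"
    using gadget_on_every_edge[OF 2(1)] by metis
  show thesis
  proof (rule that)
    \<comment> \<open>Later rounds do not change signs on \<open>E1\<close>, so the gadgets can be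
      read with the final sign set \<open>N\<close>.\<close>
    show "has_gadget E1 N u v" if "{u,v} \<in> E0" for u v
    proof (rule has_gadget_cong[OF 1(3)[OF that]])
      show "e \<in> E1 \<and> (e \<in> N \<longleftrightarrow> e \<in> N1)" if "e \<in> E1" for e
        using that signed_ext_edge[OF 2(2) that] signed_ext_edge[OF 3(2), of e] by blast
    qed
    show "has_gadget E2 N u v" if "{u,v} \<in> E1" for u v
    proof (rule has_gadget_cong[OF 2(3)[OF that]])
      show "e \<in> E2 \<and> (e \<in> N \<longleftrightarrow> e \<in> N2)" if "e \<in> E2" for e
        using that signed_ext_edge[OF 3(2) that] by blast
    qed
    show "has_gadget E N u v" if "{u,v} \<in> E2" for u v using 3(3)[OF that] .
    show "plane_graph V E F" "N \<subseteq> E" using 3(1) by (simp_all add: signed_plane_def)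
    show "E0 \<subseteq> E1" "E1 \<subseteq> E2" "E2 \<subseteq> E" using 1(2) 2(2) 3(2) by (simp_all add: signed_ext_def)
    show "{a,b} \<in> E0" by (simp add: E0_def)
  qed
qed

section \<open>Images of gadgets in \<open>H\<close>\<close>

text \<open>Consecutive steps have opposite signs and cannot retrace the same edge, so
  \<open>q i\<close> and \<open>q (i + 2)\<close> differ. With only three values the walk would go
  round a triangle, and its fourth step would repeat the first edge with the other sign. The
  parameter \<open>s\<close> admits either starting sign.\<close>

lemma alternating_walk_card:
  fixes q :: "nat \<Rightarrow> 'b" and A :: "'b \<Rightarrow> 'b \<Rightarrow> bool"
  assumes sym: "\<And>x y. A x y = A y x"
    and ne: "\<And>i. i < 4 \<Longrightarrow> q i \<noteq> q (Suc i)"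
    and alt: "\<And>i. i < 4 \<Longrightarrow> A (q i) (q (Suc i)) \<longleftrightarrow> (odd i \<longleftrightarrow> s)"
  shows "4 \<le> card (q ` {..<5})"
proof (rule ccontr)
  assume c: "\<not> 4 \<le> card (q ` {..<5})"
  have n: "q 0 \<noteq> q 1" "q 1 \<noteq> q 2" "q 2 \<noteq> q 3" "q 3 \<noteq> q 4"
    using ne[of 0] ne[of 1] ne[of 2] ne[of 3] by (simp_all add: numeral_eq_Suc)
  have a: "A (q 0) (q 1) \<noteq> s" "A (q 1) (q 2) = s" "A (q 2) (q 3) \<noteq> s" "A (q 3) (q 4) = s"
    using alt[of 0] alt[of 1] alt[of 2] alt[of 3] by (simp_all add: numeral_2_eq_2[symmetric])
  have m: "q 0 \<noteq> q 2" "q 1 \<noteq> q 3" "q 2 \<noteq> q 4" using a sym by metis+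
  have im: "q ` {..<5} = {q 0, q 1, q 2, q 3, q 4}"
    by (auto simp: numeral_eq_Suc lessThan_Suc)
  have small: "card S \<le> 3" if "S \<subseteq> q ` {..<5}" for S
    using card_mono[OF _ that] c by simp
  have "q 3 = q 0"
  proof (rule ccontr)
    assume "q 3 \<noteq> q 0"
    then have "card {q 0, q 1, q 2, q 3} = 4" using n m by auto
    then show False using small[of "{q 0, q 1, q 2, q 3}"] im by auto
  qed
  moreover have "q 4 = q 1"
  proof (rule ccontr)
    assume "q 4 \<noteq> q 1"
    then have "card {q 1, q 2, q 3, q 4} = 4" using n m by auto
    then show False using small[of "{q 1, q 2, q 3, q 4}"] im by auto
  qed
  ultimately show False using a sym by metis
qed

text \<open>Here \<open>\<pi>\<close> is the projection to \<open>H\<close> of a homomorphism into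
  \<open>AT(H)\<close>, and \<open>\<sigma>\<close> its layer: crossing between layers reverses the
  sign. Two disjoint sets of at least four images fill the eight available vertices, which gives
  both the exact count and surjectivity.\<close>

lemma gadget_image:
  fixes \<sigma> :: "'b \<Rightarrow> bool"
  assumes VH: "finite VH" "card VH = 10" and EH: "\<And>e. e \<in> EH \<Longrightarrow> e \<subseteq> VH \<and> card e = 2"
    and hom: "\<And>u v. {u,v} \<in> E \<Longrightarrow>
      {\<pi> u, \<pi> v} \<in> EH \<and> ({u,v} \<in> N \<longleftrightarrow> ({\<pi> u, \<pi> v} \<in> NH \<longleftrightarrow> \<sigma> u = \<sigma> v))"
    and uv: "{u,v} \<in> E" and g: "has_gadget E N u v"
  shows "card {w \<in> VH - {\<pi> u, \<pi> v}. {\<pi> u, w} \<in> NH \<longleftrightarrow> {\<pi> v, w} \<in> NH} = 4"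
    and "\<And>k. k \<in> VH \<Longrightarrow> k \<noteq> \<pi> u \<Longrightarrow> \<exists>r. {u,r} \<in> E \<and> \<pi> r = k"
proof -
  obtain p :: "nat \<Rightarrow> 'b" where
    p: "\<And>i. i < 10 \<Longrightarrow> {u, p i} \<in> E \<and> {u, p i} \<notin> N \<and> {v, p i} \<in> E \<and> ({v, p i} \<in> N \<longleftrightarrow> 5 \<le> i)"
    and p': "\<And>i. i < 9 \<Longrightarrow> {p i, p (Suc i)} \<in> E \<and> ({p i, p (Suc i)} \<in> N \<longleftrightarrow> odd i)"
    using g unfolding has_gadget_def by blast
  define q where "q i = \<pi> (p i)" for i
  \<comment> \<open>Negativity after switching \<open>H\<close> so that all edges at
    \<open>\<pi> u\<close> become positive. The layers cancel out, so the image of the path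
    alternates with respect to \<open>A\<close>.\<close>
  define A where "A w w' \<longleftrightarrow> (({\<pi> u, w} \<in> NH \<longleftrightarrow> {\<pi> u, w'} \<in> NH) \<longleftrightarrow> {w, w'} \<in> NH)" for w w'
  have EHne: "a \<in> VH \<and> b \<in> VH \<and> a \<noteq> b" if "{a,b} \<in> EH" for a b
    using EH[OF that] by auto
  have uq: "{\<pi> u, q i} \<in> NH \<longleftrightarrow> \<sigma> u \<noteq> \<sigma> (p i)" if "i < 10" for i
    using hom[of u "p i"] p[OF that] unfolding q_def by blast
  have vq: "{\<pi> v, q i} \<in> NH \<longleftrightarrow> (5 \<le> i \<longleftrightarrow> \<sigma> v = \<sigma> (p i))" if "i < 10" for i
    using hom[of v "p i"] p[OF that] unfolding q_def by blast
  have Asym: "A x y = A y x" for x y unfolding A_def by (auto simp: insert_commute)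
  have Aq: "A (q i) (q (Suc i)) \<longleftrightarrow> odd i" if "i < 9" for i
    using hom[of "p i" "p (Suc i)"] p'[OF that] uq[of i] uq[of "Suc i"] that
    unfolding A_def q_def by auto
  have ne: "q i \<noteq> q (Suc i)" if "i < 9" for i
    using EHne[of "q i" "q (Suc i)"] hom[of "p i" "p (Suc i)"] p'[OF that] unfolding q_def by blast
  let ?U = "VH - {\<pi> u, \<pi> v}"
  have qU: "q i \<in> ?U" if "i < 10" for i
  proof -
    have "{\<pi> u, q i} \<in> EH" "{\<pi> v, q i} \<in> EH"
      using hom[of u "p i"] hom[of v "p i"] p[OF that] unfolding q_def by blast+
    then show ?thesis using EHne[of "\<pi> u" "q i"] EHne[of "\<pi> v" "q i"] by auto
  qed
  have c1: "4 \<le> card (q ` {..<5})"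
    by (rule alternating_walk_card[of A q True]) (use Asym Aq ne in auto)
  \<comment> \<open>Shifting the index by five flips its parity, hence \<open>False\<close> in place
    of \<open>True\<close>.\<close>
  have "4 \<le> card ((\<lambda>i. q (5 + i)) ` {..<5})"
  proof (rule alternating_walk_card[of A _ False])
    fix i :: nat assume "i < 4"
    then show "q (5 + i) \<noteq> q (5 + Suc i)" "A (q (5 + i)) (q (5 + Suc i)) = (odd i = False)"
      using ne[of "5 + i"] Aq[of "5 + i"] by simp_all
  qed (rule Asym)
  moreover have "(\<lambda>i. q (5 + i)) ` {..<5} = q ` {5..<10}"
  proof -
    have "{5..<10::nat} = (+) 5 ` {..<5}" using image_add_atLeastLessThan[of 5 0 5] by (simp add: lessThan_atLeast0)
    then show ?thesis by (simp add: image_image)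
  qed
  ultimately have c2: "4 \<le> card (q ` {5..<10})" by simp
  let ?a = "\<lambda>w. {\<pi> u, w} \<in> NH \<longleftrightarrow> {\<pi> v, w} \<in> NH"
  let ?AG = "{w \<in> ?U. ?a w}" and ?DG = "{w \<in> ?U. \<not> ?a w}"
  have fin: "finite ?AG" "finite ?DG" "finite ?U" using VH(1) by auto
  have "\<pi> u \<in> VH" "\<pi> v \<in> VH" "\<pi> u \<noteq> \<pi> v" using hom[OF uv] EHne by blast+
  then have cU: "card ?U = 8" using VH by (simp add: card_Diff_subset)
  have "?AG \<union> ?DG = ?U" "?AG \<inter> ?DG = {}" by auto
  then have sum: "card ?AG + card ?DG = 8" using cU card_Un_disjoint[OF fin(1,2)] by simp
  \<comment> \<open>Whether \<open>u\<close> and \<open>v\<close> go to the same layer decides which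
    stretch yields agreeing signs; in either case the two stretches go to complementary
    sets.\<close>
  have ag: "?a (q i) \<longleftrightarrow> ((i < 5) = (\<sigma> u = \<sigma> v))" if "i < 10" for i
    using uq[OF that] vq[OF that] by auto
  have sAG: "q ` I \<subseteq> ?AG" if "\<And>i. i \<in> I \<Longrightarrow> i < 10 \<and> ((i < 5) = (\<sigma> u = \<sigma> v))" for I
  proof (rule image_subsetI)
    fix i assume "i \<in> I"
    then show "q i \<in> ?AG" using that[of i] qU[of i] ag[of i] by simp
  qed
  have sDG: "q ` I \<subseteq> ?DG" if "\<And>i. i \<in> I \<Longrightarrow> i < 10 \<and> ((i < 5) \<noteq> (\<sigma> u = \<sigma> v))" for I
  proof (rule image_subsetI)
    fix i assume "i \<in> I"
    then have "\<not> ?a (q i)" "i < 10" using that[of i] ag[of i] by blast+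
    then show "q i \<in> ?DG" using qU[of i] by blast
  qed
  \<comment> \<open>Two disjoint sets of total size eight each contain at least four images, so both
    are filled exactly.\<close>
  have "card ?AG = 4 \<and> ?U \<subseteq> q ` {..<10}"
  proof (cases "\<sigma> u = \<sigma> v")
    case True
    have s: "q ` {..<5} \<subseteq> ?AG" "q ` {5..<10} \<subseteq> ?DG" using True by (intro sAG sDG; simp)+
    have "card (q ` {..<5}) \<le> card ?AG" "card (q ` {5..<10}) \<le> card ?DG"
      using card_mono[OF fin(1) s(1)] card_mono[OF fin(2) s(2)] .
    then have "card ?AG = 4" "card ?DG = 4" "card (q ` {..<5}) = 4" "card (q ` {5..<10}) = 4"
      using c1 c2 sum by linarith+
    moreover from this have "q ` {..<5} = ?AG" "q ` {5..<10} = ?DG"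
      using card_subset_eq[OF fin(1) s(1)] card_subset_eq[OF fin(2) s(2)] by simp_all
    then have "?U = q ` {..<5} \<union> q ` {5..<10}" by blast
    ultimately show ?thesis by auto
  next
    case False
    have s: "q ` {5..<10} \<subseteq> ?AG" "q ` {..<5} \<subseteq> ?DG" using False by (intro sAG sDG; simp)+
    have "card (q ` {5..<10}) \<le> card ?AG" "card (q ` {..<5}) \<le> card ?DG"
      using card_mono[OF fin(1) s(1)] card_mono[OF fin(2) s(2)] .
    then have "card ?AG = 4" "card ?DG = 4" "card (q ` {..<5}) = 4" "card (q ` {5..<10}) = 4"
      using c1 c2 sum by linarith+
    moreover from this have "q ` {5..<10} = ?AG" "q ` {..<5} = ?DG"
      using card_subset_eq[OF fin(1) s(1)] card_subset_eq[OF fin(2) s(2)] by simp_all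
    then have "?U = q ` {..<5} \<union> q ` {5..<10}" by blast
    ultimately show ?thesis by auto
  qed
  then have ag4: "card ?AG = 4" and cover: "?U \<subseteq> q ` {..<10}" by (rule conjunct1, rule conjunct2)
  show "card ?AG = 4" by (rule ag4)
  fix k assume k: "k \<in> VH" "k \<noteq> \<pi> u"
  show "\<exists>r. {u,r} \<in> E \<and> \<pi> r = k"
  proof (cases "k = \<pi> v")
    case True then show ?thesis using uv by blast
  next
    case False
    then have "k \<in> ?U" using k by simp
    then have "k \<in> q ` {..<10}" using cover by (rule rev_subsetD)
    then obtain i where "i < 10" "k = q i" by auto
    then show ?thesis using p[of i] unfolding q_def by (intro exI[of _ "p i"]) simp
  qed
qed

section \<open>Uniqueness of the conference matrix of order 10\<close>

text \<open>Every edge lies in a unique triangle, and these triangles become the rows and columns.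
  Two triangles through \<open>y\<close> serve as axes; the other four vertices are the second
  common neighbours of pairs with one vertex on each axis.\<close>

lemma srg_9_4_1_2_is_rook:
  fixes R :: "'b \<Rightarrow> 'b \<Rightarrow> bool"
  assumes W: "finite W" "card W = 9"
    and sym: "\<And>x y. R x y \<Longrightarrow> R y x" and irr: "\<And>x. \<not> R x x" and RW: "\<And>x y. R x y \<Longrightarrow> x \<in> W \<and> y \<in> W"
    and deg: "\<And>x. x \<in> W \<Longrightarrow> card {w. R x w} = 4"
    and c1: "\<And>x y. R x y \<Longrightarrow> card {w. R x w \<and> R y w} = 1"
    and c2: "\<And>x y. x \<in> W \<Longrightarrow> y \<in> W \<Longrightarrow> x \<noteq> y \<Longrightarrow> \<not> R x y \<Longrightarrow> card {w. R x w \<and> R y w} = 2"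
  obtains q :: "int \<times> int \<Rightarrow> 'b" where "bij_betw q F9 W"
    "\<And>s t. s \<in> F9 \<Longrightarrow> t \<in> F9 \<Longrightarrow> s \<noteq> t \<Longrightarrow> R (q s) (q t) \<longleftrightarrow> fst s = fst t \<or> snd s = snd t"
proof -
  have U: "c = d" if "R x y" "R x c" "R y c" "R x d" "R y d" for x y c d
  proof -
    from c1[OF that(1)] obtain z where "{w. R x w \<and> R y w} = {z}" by (rule card_1_singletonE)
    moreover have "c \<in> {w. R x w \<and> R y w}" "d \<in> {w. R x w \<and> R y w}" using that by simp_all
    ultimately show ?thesis by simp
  qed
  have T: "\<exists>c. R x c \<and> R y c" if "R x y" for x y
  proof -
    from c1[OF that] obtain z where "{w. R x w \<and> R y w} = {z}" by (rule card_1_singletonE)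
    then have "z \<in> {w. R x w \<and> R y w}" by simp
    then show ?thesis by blast
  qed
  \<comment> \<open>Nonadjacent vertices have exactly two common neighbours; \<open>c\<close> is the
    one other than \<open>o'\<close>.\<close>
  have D: "\<exists>c. c \<noteq> o' \<and> R x c \<and> R y c" if "\<not> R x y" "x \<noteq> y" "R o' x" "R o' y" for x y o'
  proof -
    have "card {w. R x w \<and> R y w} = 2" using that c2 RW by blast
    then obtain z z' where "{w. R x w \<and> R y w} = {z,z'}" "z \<noteq> z'" by (meson card_2_iff)
    moreover from this have "z \<in> {w. R x w \<and> R y w}" "z' \<in> {w. R x w \<and> R y w}" by simp_all
    ultimately show ?thesis by (cases "z = o'") auto
  qed
  have finN: "finite {w. R x w}" for x using W(1) RW by (metis mem_Collect_eq rev_finite_subset subsetI)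
  have nbr: "{w. R x w} = {c1,c2,c3,c4}"
    if "R x c1" "R x c2" "R x c3" "R x c4" "distinct [c1,c2,c3,c4]" for x c1 c2 c3 c4
  proof -
    have "{c1,c2,c3,c4} \<subseteq> {w. R x w}" using that by simp
    moreover have "card {c1,c2,c3,c4} = 4" using that(5) by simp
    moreover have "x \<in> W" using that(1) RW by blast
    ultimately show ?thesis using card_subset_eq[OF finN] deg by metis
  qed
  have "W \<noteq> {}" using W(2) by auto
  then obtain y where y: "y \<in> W" by blast
  have "{w. R y w} \<noteq> {}" using deg[OF y] by (metis card.empty zero_neq_numeral)
  then obtain a where ya: "R y a" by blast
  obtain a' where a': "R y a'" "R a a'" using T[OF ya] by blast
  \<comment> \<open>The first triangle takes two of the four neighbours of \<open>y\<close>, so some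
    \<open>b\<close> is left to start a second triangle through \<open>y\<close>.\<close>
  have "\<not> {w. R y w} \<subseteq> {a,a'}"
  proof
    assume "{w. R y w} \<subseteq> {a,a'}"
    then have "card {w. R y w} \<le> card {a,a'}" by (intro card_mono) auto
    also have "\<dots> \<le> 2" by (simp add: card_insert_if)
    finally show False using deg[OF y] by simp
  qed
  then obtain b where yb: "R y b" "b \<noteq> a" "b \<noteq> a'" by blast
  obtain b' where b': "R y b'" "R b b'" using T[OF yb(1)] by blast
  have nadj: "\<not> R a b" "\<not> R a' b"     using U[of y a b a'] U[of y a' b a] ya a' yb sym[OF a'(2)] by blast+
  have bn: "b' \<noteq> a" "b' \<noteq> a'" using nadj sym[OF b'(2)] by blast+
  have nadj': "\<not> R a b'" "\<not> R a' b'"     using U[of y a b' a'] U[of y a' b' a] ya a' bn b' sym[OF a'(2)] by blast+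
  have ab: "a \<noteq> a'" "b \<noteq> b'" "y \<noteq> a" "y \<noteq> a'" "y \<noteq> b" "y \<noteq> b'" 
    using irr[of a] irr[of b] irr[of y] a' b' ya yb by auto
  obtain p where p: "p \<noteq> y" "R a p" "R b p" using D[OF nadj(1) _ ya yb(1)] yb by auto
  obtain q where q: "q \<noteq> y" "R a q" "R b' q" using D[OF nadj'(1) _ ya b'(1)] bn by auto
  obtain r where r: "r \<noteq> y" "R a' r" "R b r" using D[OF nadj(2) _ a'(1) yb(1)] yb by auto
  obtain s where s: "s \<noteq> y" "R a' s" "R b' s" using D[OF nadj'(2) _ a'(1) b'(1)] bn by auto
  \<comment> \<open>Two vertices of one triangle through \<open>y\<close> have \<open>y\<close> as
    their only common neighbour.\<close>
  have X: "\<not> (R a c \<and> R a' c)" "\<not> (R b c \<and> R b' c)" if "c \<noteq> y" for c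
    using that U[of a a' c y] U[of b b' c y] a' b' sym[OF ya] sym[OF a'(1)] sym[OF yb(1)] sym[OF b'(1)] by blast+
  have ny: "{w. R y w} = {a,a',b,b'}" using ya a' yb b' bn ab by (intro nbr) auto
  have out: "\<not> R y p" "\<not> R y q" "\<not> R y r" "\<not> R y s"
  proof -
    have "\<not> R y c" if "R x c" "R x' c" "x \<in> {a,a'}" "x' \<in> {b,b'}" for x x' c
    proof
      assume "R y c"
      then have "c \<in> {a,a',b,b'}" using ny by blast
      then show False using that nadj nadj' irr sym by (elim insertE emptyE) blast+
    qed
    then show "\<not> R y p" "\<not> R y q" "\<not> R y r" "\<not> R y s" using p q r s by blast+
  qed
  have d1: "p \<noteq> q" "p \<noteq> r" "p \<noteq> s" "q \<noteq> r" "q \<noteq> s" "r \<noteq> s" 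
    using X[OF p(1)] X[OF q(1)] X[OF r(1)] p q r s by auto
  have d2: "z \<notin> {a,a',b,b'}" if "z \<in> {p,q,r,s}" for z using that out ya a' yb b' by auto
  have na: "{w. R a w} = {y,a',p,q}" using ya sym a' p q d1 ab d2 by (intro nbr) auto
  have na': "{w. R a' w} = {y,a,r,s}" using ya sym a' r s d1 ab d2 by (intro nbr) auto
  have nb: "{w. R b w} = {y,b',p,r}" using yb sym b' p r d1 ab d2 by (intro nbr) auto
  have nb': "{w. R b' w} = {y,b,q,s}" using yb sym b' q s d1 ab d2 by (intro nbr) auto
  \<comment> \<open>The third vertex of the triangle on \<open>ap\<close> is a neighbour of
    \<open>a\<close>; excluding \<open>y\<close>, \<open>a'\<close> and \<open>p\<close> leaves
    \<open>q\<close>. The next three steps repeat this along the other lines.\<close>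
  have pq: "R p q"
  proof -
    obtain c where c: "R a c" "R p c" using T[OF p(2)] by blast
    then have "c \<in> {y,a',p,q}" using na by blast
    moreover have "c \<noteq> y" "c \<noteq> a'" "c \<noteq> p" using c out sym[OF c(2)] X(1)[OF p(1)] p(2) irr[of p] by auto
    ultimately show ?thesis using c by blast
  qed
  have rs: "R r s"
  proof -
    obtain c where c: "R a' c" "R r c" using T[OF r(2)] by blast
    then have "c \<in> {y,a,r,s}" using na' by blast
    moreover have "c \<noteq> y" "c \<noteq> a" "c \<noteq> r" using c out sym[OF c(2)] X(1)[OF r(1)] r(2) irr[of r] by auto
    ultimately show ?thesis using c by blast
  qed
  have pr: "R p r"
  proof -
    obtain c where c: "R b c" "R p c" using T[OF p(3)] by blast
    then have "c \<in> {y,b',p,r}" using nb by blast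
    moreover have "c \<noteq> y" "c \<noteq> b'" "c \<noteq> p" using c out sym[OF c(2)] X(2)[OF p(1)] p(3) irr[of p] by auto
    ultimately show ?thesis using c by blast
  qed
  have qs: "R q s"
  proof -
    obtain c where c: "R b' c" "R q c" using T[OF q(3)] by blast
    then have "c \<in> {y,b,q,s}" using nb' by blast
    moreover have "c \<noteq> y" "c \<noteq> b" "c \<noteq> q" using c out sym[OF c(2)] X(2)[OF q(1)] q(3) irr[of q] by auto
    ultimately show ?thesis using c by blast
  qed
  have d3: "p \<noteq> a" "p \<noteq> a'" "p \<noteq> b" "p \<noteq> b'" "q \<noteq> a" "q \<noteq> a'" "q \<noteq> b" "q \<noteq> b'"
    "r \<noteq> a" "r \<noteq> a'" "r \<noteq> b" "r \<noteq> b'" "s \<noteq> a" "s \<noteq> a'" "s \<noteq> b" "s \<noteq> b'" using d2 by blast+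
  have np: "{w. R p w} = {a,b,q,r}" using p sym pq pr d1 d3 yb by (intro nbr) auto
  have nq: "{w. R q w} = {a,b',p,s}" using q sym pq qs d1 d3 bn by (intro nbr) auto
  have nr: "{w. R r w} = {a',b,p,s}" using r sym rs pr d1 d3 yb by (intro nbr) auto
  have ns: "{w. R s w} = {a',b',q,r}" using s sym rs qs d1 d3 bn by (intro nbr) auto
  have dist: "distinct [y,a,a',b,b',p,q,r,s]"
    using ab yb bn d1 d3 p(1) q(1) r(1) s(1) by auto
  have "{y,a,a',b,b',p,q,r,s} \<subseteq> W" using RW ya a' yb b' p q r s by blast
  moreover have "card {y,a,a',b,b',p,q,r,s} = 9" using distinct_card[OF dist] by simp
  ultimately have WE: "W = {y,a,a',b,b',p,q,r,s}" using card_subset_eq[OF W(1)] W(2) by metis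
  \<comment> \<open>The axis \<open>y\<close>, \<open>a\<close>, \<open>a'\<close> has second
    coordinate 0, the axis \<open>y\<close>, \<open>b\<close>, \<open>b'\<close> first coordinate 0;
    each of \<open>p\<close>, \<open>q\<close>, \<open>r\<close>, \<open>s\<close> takes its
    coordinates from the two axis vertices that define it.\<close>
  define f :: "int \<times> int \<Rightarrow> 'b" where "f z = (if z = (0,0) then y else if z = (1,0) then a else if z = (2,0) then a'
     else if z = (0,1) then b else if z = (0,2) then b' else if z = (1,1) then p else if z = (1,2) then q
     else if z = (2,1) then r else s)" for z
  have F9: "F9 = {(0,0),(1,0),(2,0),(0,1),(0,2),(1,1),(1,2),(2,1),(2,2)}"
  proof -
    have "{0..2::int} = {0,1,2}" by auto
    then show ?thesis unfolding F9_def by auto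
  qed
  have fW: "f ` F9 = W" unfolding F9 WE by (simp add: f_def) blast
  have fin9: "finite F9" "card F9 = 9" unfolding F9 by simp_all
  have "bij_betw f F9 W" unfolding bij_betw_def using fW eq_card_imp_inj_on[OF fin9(1), of f] fin9(2) W(2) by simp
  moreover have "R (f z) (f z') \<longleftrightarrow> fst z = fst z' \<or> snd z = snd z'" if "z \<in> F9" "z' \<in> F9" "z \<noteq> z'" for z z'
  proof -
    have R: "R x w \<longleftrightarrow> w \<in> {w. R x w}" for x w by simp
    note rows = R[of y, unfolded ny] R[of a, unfolded na] R[of a', unfolded na'] R[of b, unfolded nb]
      R[of b', unfolded nb'] R[of p, unfolded np] R[of q, unfolded nq] R[of r, unfolded nr] R[of s, unfolded ns]
    have ds: "y \<noteq> a" "a \<noteq> y" "y \<noteq> a'" "a' \<noteq> y" "y \<noteq> b" "b \<noteq> y" "y \<noteq> b'" "b' \<noteq> y"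
      "a \<noteq> a'" "a' \<noteq> a" "a \<noteq> b" "b \<noteq> a" "a \<noteq> b'" "b' \<noteq> a" "a' \<noteq> b" "b \<noteq> a'" "a' \<noteq> b'" "b' \<noteq> a'" "b \<noteq> b'" "b' \<noteq> b"
      using dist by auto
    show ?thesis using that unfolding F9
      by (elim insertE emptyE) (simp_all add: f_def rows ds d1 d1[symmetric] d3 d3[symmetric] p(1) q(1) r(1) s(1)
        p(1)[symmetric] q(1)[symmetric] r(1)[symmetric] s(1)[symmetric])
  qed
  ultimately show thesis using that by blast
qed

text \<open>\<open>B\<close> stands for the positive edges of a switched \<open>H\<close> in which
  all edges at \<open>x\<close> are positive. Balance at \<open>x\<close> and \<open>y\<close> gives
  degree four; balance at two other vertices gives their number of common neighbours by
  inclusion-exclusion.\<close>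

lemma conference_link_is_rook:
  fixes B :: "'b \<Rightarrow> 'b \<Rightarrow> bool"
  assumes VH: "finite VH" "card VH = 10" and x: "x \<in> VH"
    and sym: "\<And>a b. B a b = B b a"
    and bal: "\<And>a b. a \<in> VH \<Longrightarrow> b \<in> VH \<Longrightarrow> a \<noteq> b \<Longrightarrow> card {w \<in> VH - {a,b}. B a w = B b w} = 4"
    and Bx: "\<And>y. y \<in> VH \<Longrightarrow> y \<noteq> x \<Longrightarrow> B x y"
  obtains q :: "int \<times> int \<Rightarrow> 'b" where "bij_betw q F9 (VH - {x})"
    "\<And>s t. s \<in> F9 \<Longrightarrow> t \<in> F9 \<Longrightarrow> s \<noteq> t \<Longrightarrow> B (q s) (q t) \<longleftrightarrow> fst s = fst t \<or> snd s = snd t"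
proof -
  define W where "W = VH - {x}"
  define R where "R a b \<longleftrightarrow> a \<in> W \<and> b \<in> W \<and> a \<noteq> b \<and> B a b" for a b
  have W: "finite W" "card W = 9" using VH x by (simp_all add: W_def)
  have deg: "card {w. R y w} = 4" if "y \<in> W" for y
  proof -
    have "{w. R y w} = {w \<in> VH - {x,y}. B x w = B y w}"
      using that Bx unfolding R_def W_def by auto
    then show ?thesis using bal[of x y] that x unfolding W_def by auto
  qed
  have finR: "finite {w. R y w}" for y by (rule finite_subset[OF _ W(1)]) (auto simp: R_def)
  have common: "card {w. R y w \<and> R z w} = (if R y z then 1 else 2)" if yz: "y \<in> W" "z \<in> W" "y \<noteq> z" for y z
  proof -
    let ?Y = "{w. R y w}" and ?Z = "{w. R z w}"
    let ?C = "{w. R y w \<and> R z w}" and ?O = "W - {y,z} - (?Y \<union> ?Z)"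
    have C: "?C = ?Y \<inter> ?Z" by blast
    have un: "card (?Y \<union> ?Z) + card ?C = 8"
      using card_Un_Int[OF finR[of y] finR[of z]] deg yz unfolding C by simp
    have B: "B y x" "B z x" using Bx sym yz unfolding W_def by blast+
    \<comment> \<open>A vertex where \<open>y\<close> and \<open>z\<close> agree is
      \<open>x\<close>, a common neighbour or a common non-neighbour, so the last two kinds number
      three in all.\<close>
    have "{w \<in> VH - {y,z}. B y w = B z w} = insert x (?C \<union> ?O)"
      using B yz x unfolding R_def W_def by auto
    moreover have "x \<notin> ?C \<union> ?O" unfolding R_def W_def by auto
    moreover have fin: "finite ?C" "finite ?O" using finR[of y] W(1) by auto
    moreover have "?C \<inter> ?O = {}" by blast
    ultimately have four: "card ?C + card ?O = 3"
      using bal[of y z] yz unfolding W_def[symmetric] by (simp add: card_Un_disjoint W_def)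
    have sub: "?Y \<union> ?Z \<subseteq> W" by (auto simp: R_def)
    have Rsym: "R z y \<longleftrightarrow> R y z" using sym unfolding R_def by blast
    \<comment> \<open>Adjacent \<open>y\<close>, \<open>z\<close> lie in
      \<open>?Y \<union> ?Z\<close>, so \<open>?O\<close> has one element more than
      \<open>?C\<close>; otherwise \<open>y\<close> and \<open>z\<close> drop out as well and it has
      one fewer. With three in all, \<open>?C\<close> has one or two elements respectively.\<close>
    show ?thesis
    proof (cases "R y z")
      case True
      then have "?O = W - (?Y \<union> ?Z)" using Rsym by auto
      then have "card ?O + card (?Y \<union> ?Z) = 9"
        using card_Diff_subset[OF finite_subset[OF sub W(1)] sub] card_mono[OF W(1) sub] W(2) by simp
      then show ?thesis using un four True by simp
    next
      case False
      then have dis: "{y,z} \<inter> (?Y \<union> ?Z) = {}" using Rsym unfolding R_def by auto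
      have O: "?O = W - ({y,z} \<union> (?Y \<union> ?Z))" by blast
      have sub': "{y,z} \<union> (?Y \<union> ?Z) \<subseteq> W" using sub yz by simp
      have "card ({y,z} \<union> (?Y \<union> ?Z)) = 2 + card (?Y \<union> ?Z)"
        using card_Un_disjoint[OF _ finite_subset[OF sub W(1)] dis] yz(3) by simp
      then have "card ?O + card (?Y \<union> ?Z) = 7"
        using card_Diff_subset[OF finite_subset[OF sub' W(1)] sub'] card_mono[OF W(1) sub'] W(2)
        unfolding O by simp
      then show ?thesis using un four False by simp
    qed
  qed
  obtain q :: "int \<times> int \<Rightarrow> 'b" where q: "bij_betw q F9 W"
    "\<And>s t. s \<in> F9 \<Longrightarrow> t \<in> F9 \<Longrightarrow> s \<noteq> t \<Longrightarrow> R (q s) (q t) \<longleftrightarrow> fst s = fst t \<or> snd s = snd t"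
  proof (rule srg_9_4_1_2_is_rook[OF W, of R])
    show "R x y \<Longrightarrow> R y x" for x y using sym unfolding R_def by blast
    show "\<not> R x x" for x by (simp add: R_def)
    show "R x y \<Longrightarrow> x \<in> W \<and> y \<in> W" for x y by (simp add: R_def)
    show "y \<in> W \<Longrightarrow> card {w. R y w} = 4" for y by (rule deg)
    show "card {w. R y w \<and> R z w} = 1" if "R y z" for y z
      using common[of y z] that by (simp add: R_def)
    show "card {w. R y w \<and> R z w} = 2" if "y \<in> W" "z \<in> W" "y \<noteq> z" "\<not> R y z" for y z
      using common[of y z] that by simp
  qed blast
  have "B (q s) (q t) \<longleftrightarrow> fst s = fst t \<or> snd s = snd t" if "s \<in> F9" "t \<in> F9" "s \<noteq> t" for s t
  proof -
    have "q s \<in> W" "q t \<in> W" "q s \<noteq> q t"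
      using q(1) that by (auto simp: bij_betw_def inj_on_def)
    then show ?thesis using q(2)[OF that] by (simp add: R_def)
  qed
  then show thesis using that q(1) unfolding W_def by blast
qed

section \<open>\<open>SP_9\<close> in coordinates, and switching in anti-twinned graphs\<close>

text \<open>In the form a + bi, the squares are 0 and the fourth roots of unity, which are the
  elements on the two axes.\<close>

lemma F9_square_iff: "s \<in> F9 \<Longrightarrow> F9_square s \<longleftrightarrow> fst s = 0 \<or> snd s = 0"
proof -
  have "{0..2::int} = {0,1,2}" by auto
  then have F9: "F9 = {(0,0),(1,0),(2,0),(0,1),(0,2),(1,1),(1,2),(2,1),(2,2)}"
    unfolding F9_def by auto
  assume "s \<in> F9"
  then show "F9_square s \<longleftrightarrow> fst s = 0 \<or> snd s = 0"
    unfolding F9_square_def F9 by (elim insertE emptyE) (simp_all add: F9_mult_def)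
qed

lemma F9_sub_square:
  assumes "s \<in> F9" "t \<in> F9"
  shows "F9_square (F9_sub s t) \<longleftrightarrow> fst s = fst t \<or> snd s = snd t"
proof -
  have z: "(a - b) mod 3 = 0 \<longleftrightarrow> a = b" if "a \<in> {0..2}" "b \<in> {0..2}" for a b :: int
    using that unfolding atLeastAtMost_iff by presburger
  have "(a - b) mod 3 \<in> {0..2}" for a b :: int unfolding atLeastAtMost_iff by presburger
  then have "F9_sub s t \<in> F9" unfolding F9_sub_def F9_def by simp
  moreover have "fst s \<in> {0..2}" "snd s \<in> {0..2}" "fst t \<in> {0..2}" "snd t \<in> {0..2}"
    using assms by (auto simp: F9_def)
  ultimately show ?thesis by (simp only: F9_square_iff) (simp only: F9_sub_def fst_conv snd_conv z)
qed

text \<open>An edge does not record the order of subtraction; the criterion by coordinates is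
  symmetric, in line with -1 being a square.\<close>

lemma SP9p_neg_Some:
  assumes "s \<in> F9" "t \<in> F9" "s \<noteq> t"
  shows "{Some s, Some t} \<in> SP9p_neg \<longleftrightarrow> \<not> (fst s = fst t \<or> snd s = snd t)"
proof
  assume "{Some s, Some t} \<in> SP9p_neg"
  then obtain a b where ab: "{Some s, Some t} = {Some a, Some b}" "a \<in> F9" "b \<in> F9" "\<not> F9_square (F9_sub b a)"
    unfolding SP9p_neg_def by blast
  then have "\<not> (fst b = fst a \<or> snd b = snd a)" using F9_sub_square by blast
  then show "\<not> (fst s = fst t \<or> snd s = snd t)" using ab(1) by (auto simp: doubleton_eq_iff)
next
  assume "\<not> (fst s = fst t \<or> snd s = snd t)"
  then have "\<not> F9_square (F9_sub t s)" using F9_sub_square[OF assms(2,1)] by auto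
  then show "{Some s, Some t} \<in> SP9p_neg" unfolding SP9p_neg_def using assms by blast
qed

lemma SP9p_neg_None: "None \<in> e \<Longrightarrow> e \<notin> SP9p_neg"
  unfolding SP9p_neg_def by auto

lemma AT_edges_iff: "{(u,i),(v,j)} \<in> AT_edges E \<longleftrightarrow> {u,v} \<in> E"
proof
  assume "{(u,i),(v,j)} \<in> AT_edges E"
  then obtain a b c d where "{(u,i),(v,j)} = {(a,c),(b,d)}" "{a,b} \<in> E"
    unfolding AT_edges_def by blast
  then show "{u,v} \<in> E" by (auto simp: doubleton_eq_iff insert_commute)
qed (auto simp: AT_edges_def)

lemma AT_neg_iff: "{(u,i),(v,j)} \<in> AT_neg E N \<longleftrightarrow> {u,v} \<in> E \<and> ({u,v} \<in> N \<longleftrightarrow> i = j)"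
proof
  assume "{(u,i),(v,j)} \<in> AT_neg E N"
  then obtain a b c d where "{(u,i),(v,j)} = {(a,c),(b,d)}" "{a,b} \<in> E" "({a,b} \<in> N) = (c = d)"
    unfolding AT_neg_def mem_Collect_eq by (elim exE conjE)
  then show "{u,v} \<in> E \<and> ({u,v} \<in> N \<longleftrightarrow> i = j)" by (auto simp: doubleton_eq_iff insert_commute)
qed (auto simp: AT_neg_def)

lemma SP9p_edges_iff: "{u,v} \<in> SP9p_edges \<longleftrightarrow> u \<in> SP9p_verts \<and> v \<in> SP9p_verts \<and> u \<noteq> v"
proof
  assume "{u,v} \<in> SP9p_edges"
  then obtain a b where "{u,v} = {a,b}" "a \<in> SP9p_verts" "b \<in> SP9p_verts" "a \<noteq> b"
    unfolding SP9p_edges_def by blast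
  then show "u \<in> SP9p_verts \<and> v \<in> SP9p_verts \<and> u \<noteq> v" by (auto simp: doubleton_eq_iff)
qed (auto simp: SP9p_edges_def)

text \<open>Switching \<open>H\<close> at a set of vertices is invisible in \<open>AT(H)\<close>: it
  amounts to exchanging the two copies of each of them. So all edges at \<open>x\<close> may be
  taken to be positive, and \<open>x\<close> then corresponds to \<open>None\<close>.\<close>

lemma balanced_iso_Tr_SP9:
  fixes VH :: "'b set"
  assumes VH: "finite VH" "card VH = 10"
    and EH: "\<And>a b. {a,b} \<in> EH \<longleftrightarrow> a \<in> VH \<and> b \<in> VH \<and> a \<noteq> b"
    and bal: "\<And>a b. a \<in> VH \<Longrightarrow> b \<in> VH \<Longrightarrow> a \<noteq> b \<Longrightarrow>
      card {w \<in> VH - {a,b}. {a,w} \<in> NH \<longleftrightarrow> {b,w} \<in> NH} = 4"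
  shows "signified_isomorphic (AT_verts VH) (AT_edges EH) (AT_neg EH NH) Tr_SP9_verts Tr_SP9_edges Tr_SP9_neg"
proof -
  have "VH \<noteq> {}" using VH by auto
  then obtain x where x: "x \<in> VH" by blast
  \<comment> \<open>The switching set consists of the vertices joined negatively to
    \<open>x\<close>, with \<open>x\<close> itself kept outside. \<open>B\<close> below is
    positivity after switching.\<close>
  define \<tau> where "\<tau> w \<longleftrightarrow> w \<noteq> x \<and> {x,w} \<in> NH" for w
  define B where "B a b \<longleftrightarrow> ({a,b} \<in> NH \<longleftrightarrow> \<tau> a \<noteq> \<tau> b)" for a b
  \<comment> \<open>If exactly one of \<open>a\<close>, \<open>b\<close> is switched, agreement and
    disagreement trade places; balance survives because four is half of eight.\<close>
  have Bbal: "card {w \<in> VH - {a,b}. B a w = B b w} = 4" if ab: "a \<in> VH" "b \<in> VH" "a \<noteq> b" for a b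
  proof -
    let ?S = "{w \<in> VH - {a,b}. {a,w} \<in> NH \<longleftrightarrow> {b,w} \<in> NH}"
    show ?thesis
    proof (cases "\<tau> a = \<tau> b")
      case True
      then have "{w \<in> VH - {a,b}. B a w = B b w} = ?S" unfolding B_def by blast
      then show ?thesis using bal[OF ab] by simp
    next
      case False
      then have "{w \<in> VH - {a,b}. B a w = B b w} = (VH - {a,b}) - ?S" unfolding B_def by blast
      moreover have "card ((VH - {a,b}) - ?S) = card (VH - {a,b}) - card ?S"
        using VH(1) by (intro card_Diff_subset) auto
      moreover have "card (VH - {a,b}) = 8" using VH ab by (simp add: card_Diff_subset)
      ultimately show ?thesis using bal[OF ab] by simp
    qed
  qed
  obtain q :: "int \<times> int \<Rightarrow> 'b" where q: "bij_betw q F9 (VH - {x})"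
    "\<And>s t. s \<in> F9 \<Longrightarrow> t \<in> F9 \<Longrightarrow> s \<noteq> t \<Longrightarrow> B (q s) (q t) \<longleftrightarrow> fst s = fst t \<or> snd s = snd t"
  proof (rule conference_link_is_rook[OF VH x, of B])
    show "B a b = B b a" for a b unfolding B_def by (auto simp: insert_commute)
    show "B x y" if "y \<in> VH" "y \<noteq> x" for y using that unfolding B_def \<tau>_def by simp
  qed (use Bbal in blast)+
  define r where "r = the_inv_into F9 q"
  have r: "bij_betw r (VH - {x}) F9" unfolding r_def by (rule bij_betw_the_inv_into[OF q(1)])
  have qr: "q (r w) = w" if "w \<in> VH" "w \<noteq> x" for w
    using f_the_inv_into_f_bij_betw[OF q(1)] that unfolding r_def by simp
  define \<phi> where "\<phi> w = (if w = x then None else Some (r w))" for w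
  have rF: "r w \<in> F9" if "w \<in> VH" "w \<noteq> x" for w using r that unfolding bij_betw_def by blast
  have rne: "r a \<noteq> r b" if "a \<in> VH" "a \<noteq> x" "b \<in> VH" "b \<noteq> x" "a \<noteq> b" for a b
    using qr that by metis
  have \<phi>inj: "inj_on \<phi> VH" unfolding inj_on_def \<phi>_def using rne by auto
  have \<phi>im: "\<phi> ` VH = SP9p_verts"
  proof -
    have "\<phi> ` VH = insert (\<phi> x) (\<phi> ` (VH - {x}))" using x by blast
    also have "\<phi> ` (VH - {x}) = Some ` (r ` (VH - {x}))" unfolding image_image by (rule image_cong) (auto simp: \<phi>_def)
    finally show ?thesis using r unfolding bij_betw_def SP9p_verts_def \<phi>_def by simp
  qed
  have neg: "{\<phi> a, \<phi> b} \<in> SP9p_neg \<longleftrightarrow> \<not> B a b" if "a \<in> VH" "b \<in> VH" "a \<noteq> b" for a b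
  proof -
    consider "a = x" | "b = x" | "a \<noteq> x" "b \<noteq> x" by blast
    then show ?thesis
    proof cases
      case 1
      then have "B a b" using that unfolding B_def \<tau>_def by simp
      moreover have "{\<phi> a, \<phi> b} \<notin> SP9p_neg" by (rule SP9p_neg_None) (simp add: 1 \<phi>_def)
      ultimately show ?thesis by simp
    next
      case 2
      then have "B a b" using that unfolding B_def \<tau>_def by (simp add: insert_commute)
      moreover have "{\<phi> a, \<phi> b} \<notin> SP9p_neg" by (rule SP9p_neg_None) (simp add: 2 \<phi>_def)
      ultimately show ?thesis by simp
    next
      case 3
      then show ?thesis using that SP9p_neg_Some[OF rF rF rne, of a b] q(2)[OF rF rF rne, of a b] qr
        unfolding \<phi>_def by simp
    qed
  qed
  \<comment> \<open>The layer is flipped exactly over the switched vertices, which compensates for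
    the switching.\<close>
  define G where "G z = (\<phi> (fst z), snd z \<noteq> \<tau> (fst z))" for z
  have "bij_betw G (AT_verts VH) Tr_SP9_verts"
  proof (rule bij_betwI')
    fix z z' assume "z \<in> AT_verts VH" "z' \<in> AT_verts VH"
    then show "(G z = G z') = (z = z')"
      using \<phi>inj unfolding G_def AT_verts_def inj_on_def by (cases z; cases z') auto
  next
    fix z assume "z \<in> AT_verts VH"
    then show "G z \<in> Tr_SP9_verts" unfolding G_def AT_verts_def Tr_SP9_verts_def \<phi>im[symmetric] by auto
  next
    fix y assume "y \<in> Tr_SP9_verts"
    then obtain w i where "y = (\<phi> w, i)" "w \<in> VH"
      unfolding Tr_SP9_verts_def AT_verts_def \<phi>im[symmetric] by auto
    then show "\<exists>z\<in>AT_verts VH. y = G z"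
      by (intro bexI[of _ "(w, i \<noteq> \<tau> w)"]) (auto simp: G_def AT_verts_def)
  qed
  moreover have "({z,z'} \<in> AT_edges EH \<longleftrightarrow> {G z, G z'} \<in> Tr_SP9_edges) \<and>
      ({z,z'} \<in> AT_neg EH NH \<longleftrightarrow> {G z, G z'} \<in> Tr_SP9_neg)"
    if z: "z \<in> AT_verts VH" "z' \<in> AT_verts VH" for z z'
  proof -
    obtain a i b j where zz: "z = (a,i)" "z' = (b,j)" "a \<in> VH" "b \<in> VH"
      using z unfolding AT_verts_def by auto
    have e: "{\<phi> a, \<phi> b} \<in> SP9p_edges \<longleftrightarrow> {a,b} \<in> EH"
      using zz(3,4) \<phi>im inj_on_eq_iff[OF \<phi>inj zz(3,4)] unfolding SP9p_edges_iff EH by blast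
    have "a \<noteq> b \<Longrightarrow> ({\<phi> a, \<phi> b} \<in> SP9p_neg) = ((i \<noteq> \<tau> a) = (j \<noteq> \<tau> b)) \<longleftrightarrow> ({a,b} \<in> NH) = (i = j)"
      using neg[OF zz(3,4)] unfolding B_def by auto
    then show ?thesis
      unfolding zz G_def Tr_SP9_edges_def Tr_SP9_neg_def fst_conv snd_conv AT_edges_iff AT_neg_iff e
      using EH by blast
  qed
  ultimately have "signified_iso (AT_verts VH) (AT_edges EH) (AT_neg EH NH) Tr_SP9_verts Tr_SP9_edges Tr_SP9_neg G"
    unfolding signified_iso_def by simp
  then show ?thesis unfolding signified_isomorphic_def by blast
qed

section \<open>Universality for planar graphs applied to \<open>H\<close>\<close>

lemma signified_isomorphic_trans:
  assumes "signified_isomorphic V E N W F M" "signified_isomorphic W F M U G L"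
  shows "signified_isomorphic V E N U G L"
proof -
  obtain f g where f: "signified_iso V E N W F M f" and g: "signified_iso W F M U G L g"
    using assms unfolding signified_isomorphic_def by blast
  have "f v \<in> W" if "v \<in> V" for v using f that unfolding signified_iso_def bij_betw_def by blast
  then have "signified_iso V E N U G L (g \<circ> f)"
    using f g bij_betw_trans[of f V W g U] unfolding signified_iso_def by simp
  then show ?thesis unfolding signified_isomorphic_def by blast
qed

text \<open>The hypothesis \<open>univ\<close> expresses a homomorphism into \<open>AT(H)\<close> as
  a projection \<open>\<pi>\<close> and a layer \<open>\<sigma>\<close>.\<close>

lemma planar_universal_balanced:
  fixes VH :: "'b set" 
  assumes VH: "finite VH" "card VH = 10" and EH: "\<And>e. e \<in> EH \<Longrightarrow> e \<subseteq> VH \<and> card e = 2"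
    and univ: "\<And>(V :: (real^2) set) E N F. plane_graph V E F \<Longrightarrow> N \<subseteq> E \<Longrightarrow>
      \<exists>\<pi> \<sigma>. \<forall>u v. {u,v} \<in> E \<longrightarrow>
        {\<pi> u, \<pi> v} \<in> EH \<and> ({u,v} \<in> N \<longleftrightarrow> ({\<pi> u, \<pi> v} \<in> NH \<longleftrightarrow> \<sigma> u = (\<sigma> v :: bool)))"
    and hk: "h \<in> VH" "k \<in> VH" "h \<noteq> k"
  shows "{h,k} \<in> EH" "card {w \<in> VH - {h,k}. {h,w} \<in> NH \<longleftrightarrow> {k,w} \<in> NH} = 4"
proof -
  obtain V :: "(real^2) set" and E N F E0 E1 E2 u v where G: "plane_graph V E F" "N \<subseteq> E"
    "{u,v} \<in> E0" "E0 \<subseteq> E1" "E1 \<subseteq> E2" "E2 \<subseteq> E"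
    and g: "\<And>u v. {u,v} \<in> E0 \<Longrightarrow> has_gadget E1 N u v"
    "\<And>u v. {u,v} \<in> E1 \<Longrightarrow> has_gadget E2 N u v"
    "\<And>u v. {u,v} \<in> E2 \<Longrightarrow> has_gadget E N u v"
    by (rule three_rounds) blast
  obtain \<pi> \<sigma> where hom: "\<And>u v. {u,v} \<in> E \<Longrightarrow>
      {\<pi> u, \<pi> v} \<in> EH \<and> ({u,v} \<in> N \<longleftrightarrow> ({\<pi> u, \<pi> v} \<in> NH \<longleftrightarrow> \<sigma> u = (\<sigma> v :: bool)))"
    using univ[OF G(1,2)] by blast
  have hom2: "{\<pi> u, \<pi> v} \<in> EH \<and> ({u,v} \<in> N \<longleftrightarrow> ({\<pi> u, \<pi> v} \<in> NH \<longleftrightarrow> \<sigma> u = \<sigma> v))" if "{u,v} \<in> E2" for u v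
    using hom that G(6) by blast
  have hom1: "{\<pi> u, \<pi> v} \<in> EH \<and> ({u,v} \<in> N \<longleftrightarrow> ({\<pi> u, \<pi> v} \<in> NH \<longleftrightarrow> \<sigma> u = \<sigma> v))" if "{u,v} \<in> E1" for u v
    using hom2 that G(5) by blast
  have uv: "{u,v} \<in> E1" using G(3,4) by blast
  \<comment> \<open>Round one: some end \<open>s\<close> of an edge in \<open>E1\<close> lies over
    \<open>h\<close>.\<close>
  obtain s t where s: "{s,t} \<in> E1" "\<pi> s = h"
  proof (cases "h = \<pi> u")
    case True then show ?thesis using that uv by blast
  next
    case False
    obtain r where "{u,r} \<in> E1" "\<pi> r = h"
      using gadget_image(2)[OF VH EH hom1 uv g(1)[OF G(3)] hk(1) False] by blast
    then show ?thesis using that[of r u] by (simp add: insert_commute)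
  qed
  have st: "{s,t} \<in> E2" using s(1) G(5) by blast
  \<comment> \<open>Round two: \<open>s\<close> has a neighbour \<open>r\<close> over
    \<open>k\<close>.\<close>
  have "k \<noteq> \<pi> s" using s(2) hk(3) by simp
  then obtain r where r: "{s,r} \<in> E2" "\<pi> r = k"
    using gadget_image(2)[OF VH EH hom2 st g(2)[OF s(1)] hk(2)] by blast
  have sr: "{s,r} \<in> E" using r(1) G(6) by blast
  show "{h,k} \<in> EH" using hom[OF sr] s(2) r(2) by simp
  \<comment> \<open>Round three: the edge \<open>sr\<close> over \<open>hk\<close> itself carries a
    gadget.\<close>
  show "card {w \<in> VH - {h,k}. {h,w} \<in> NH \<longleftrightarrow> {k,w} \<in> NH} = 4"
    using gadget_image(1)[OF VH EH hom sr g(3)[OF r(1)]] s(2) r(2) by simp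
qed

text \<open>The assumption speaks of graphs on natural numbers, so the finite point set is numbered
  by an injection \<open>i\<close>, and the homomorphism found is composed with it.\<close>

lemma signified_hom_plane_graph:
  assumes univ: "\<forall>(G::nat set) EG NG. signified_graph G EG NG \<and> planar G EG \<longrightarrow>
           (\<exists>f. signified_hom G EG NG V E N f)"
    and P: "plane_graph (VP :: (real^2) set) EP FP" and NP: "NP \<subseteq> EP"
  shows "\<exists>f. signified_hom VP EP NP V E N f"
proof -
  interpret plane_graph VP EP FP by fact
  obtain i :: "real^2 \<Rightarrow> nat" where i: "inj_on i VP" using finite_imp_inj_to_nat_seg[OF finite_V] by blast
  have im: "i ` e = i ` e' \<longleftrightarrow> e = e'" if "e \<subseteq> VP" "e' \<subseteq> VP" for e e'
    using inj_on_image_eq_iff[OF i that] .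
  have "signified_graph (i ` VP) ((`) i ` EP) ((`) i ` NP)"
    unfolding signified_graph_def
  proof (intro conjI ballI)
    show "finite (i ` VP)" using finite_V by simp
    show "(`) i ` NP \<subseteq> (`) i ` EP" using NP by blast
    fix e' assume "e' \<in> (`) i ` EP"
    then obtain e where e: "e \<in> EP" "e' = i ` e" by blast
    then show "e' \<subseteq> i ` VP" using edge by blast
    show "card e' = 2" using e edge[OF e(1)] card_image[OF inj_on_subset[OF i]] by simp
  qed
  then obtain f where f: "signified_hom (i ` VP) ((`) i ` EP) ((`) i ` NP) V E N f"
    using univ planar_transfer[OF P i] by blast
  have "signified_hom VP EP NP V E N (f \<circ> i)"
    unfolding signified_hom_def
  proof (intro conjI ballI impI)
    show "(f \<circ> i) ` VP \<subseteq> V" using f unfolding signified_hom_def by (simp add: image_comp)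
    fix u v assume uv: "u \<in> VP" "v \<in> VP" "{u,v} \<in> EP"
    have e: "{i u, i v} = i ` {u,v}" by simp
    have "{i u, i v} \<in> (`) i ` EP" unfolding e using uv(3) by (rule imageI)
    moreover have "{i u, i v} \<in> (`) i ` NP \<longleftrightarrow> {u,v} \<in> NP"
    proof
      assume "{i u, i v} \<in> (`) i ` NP"
      then obtain e' where e': "e' \<in> NP" "i ` {u,v} = i ` e'" unfolding e by (rule imageE)
      then have "{u,v} = e'" using im[of "{u,v}" e'] uv edge[of e'] NP by auto
      then show "{u,v} \<in> NP" using e'(1) by simp
    next
      assume "{u,v} \<in> NP"
      then show "{i u, i v} \<in> (`) i ` NP" unfolding e by (rule imageI)
    qed
    ultimately show "{(f \<circ> i) u, (f \<circ> i) v} \<in> E" "({u,v} \<in> NP) = ({(f \<circ> i) u, (f \<circ> i) v} \<in> N)"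
      using f uv(1,2) unfolding signified_hom_def by simp_all
  qed
  then show ?thesis by blast
qed

theorem mainTheorem15:
  fixes V :: "'a set" and E N :: "'a set set"
  assumes "signified_graph V E N"
    and "card V = 20"
    and "anti_twinned V E N"
    and "\<forall>(G::nat set) EG NG. signified_graph G EG NG \<and> planar G EG \<longrightarrow>
           (\<exists>f. signified_hom G EG NG V E N f)"
  shows "signified_isomorphic V E N Tr_SP9_verts Tr_SP9_edges Tr_SP9_neg"
proof -
  obtain VH :: "nat set" and EH NH where H: "signified_graph VH EH NH"
    and iso: "signified_isomorphic V E N (AT_verts VH) (AT_edges EH) (AT_neg EH NH)"
    using assms(3) unfolding anti_twinned_def by blast
  then obtain g where g: "signified_iso V E N (AT_verts VH) (AT_edges EH) (AT_neg EH NH) g"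
    unfolding signified_isomorphic_def by blast
  have fin: "finite VH" and EH: "\<And>e. e \<in> EH \<Longrightarrow> e \<subseteq> VH \<and> card e = 2"
    using H unfolding signified_graph_def by blast+
  have "card (AT_verts VH) = 20"
    using g assms(2) bij_betw_same_card unfolding signified_iso_def by metis
  then have card: "card VH = 10" by (simp add: AT_verts_def card_cartesian_product)
  \<comment> \<open>After the isomorphism \<open>g\<close> onto \<open>AT(H)\<close>, the first
    coordinate is the map to \<open>H\<close> and the second the layer; the sign rule of
    \<open>AT(H)\<close> relates them.\<close>
  have univ: "\<exists>\<pi> \<sigma>. \<forall>u v. {u,v} \<in> EP \<longrightarrow>
        {\<pi> u, \<pi> v} \<in> EH \<and> ({u,v} \<in> NP \<longleftrightarrow> ({\<pi> u, \<pi> v} \<in> NH \<longleftrightarrow> \<sigma> u = (\<sigma> v :: bool)))"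
    if P: "plane_graph (VP :: (real^2) set) EP FP" "NP \<subseteq> EP" for VP EP FP NP
  proof -
    obtain f where f: "signified_hom VP EP NP V E N f"
      using signified_hom_plane_graph[OF assms(4) P] by blast
    have "{fst (g (f u)), fst (g (f v))} \<in> EH \<and> ({u,v} \<in> NP \<longleftrightarrow>
        ({fst (g (f u)), fst (g (f v))} \<in> NH \<longleftrightarrow> snd (g (f u)) = snd (g (f v))))" if "{u,v} \<in> EP" for u v
    proof -
      have "u \<in> VP" "v \<in> VP" using plane_graph.edge[OF P(1) that] by auto
      then have "f u \<in> V" "f v \<in> V" "{f u, f v} \<in> E" "{u,v} \<in> NP \<longleftrightarrow> {f u, f v} \<in> N"
        using f that unfolding signified_hom_def by blast+
      then have "{g (f u), g (f v)} \<in> AT_edges EH" "{u,v} \<in> NP \<longleftrightarrow> {g (f u), g (f v)} \<in> AT_neg EH NH"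
        using g unfolding signified_iso_def by blast+
      then show ?thesis
        using AT_edges_iff[of "fst (g (f u))" "snd (g (f u))" "fst (g (f v))" "snd (g (f v))" EH]
          AT_neg_iff[of "fst (g (f u))" "snd (g (f u))" "fst (g (f v))" "snd (g (f v))" EH NH] by simp
    qed
    then show ?thesis by (intro exI[of _ "fst \<circ> g \<circ> f"] exI[of _ "snd \<circ> g \<circ> f"]) simp
  qed
  note bal = planar_universal_balanced[OF fin card EH univ]
  have "signified_isomorphic (AT_verts VH) (AT_edges EH) (AT_neg EH NH) Tr_SP9_verts Tr_SP9_edges Tr_SP9_neg"
  proof (rule balanced_iso_Tr_SP9[OF fin card])
    \<comment> \<open>\<open>H\<close> is complete, because every pair of distinct vertices is the
      image of an edge.\<close>
    show "{a,b} \<in> EH \<longleftrightarrow> a \<in> VH \<and> b \<in> VH \<and> a \<noteq> b" for a b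
      using EH[of "{a,b}"] bal(1)[where h = a and k = b] by auto
  qed (rule bal(2))
  then show ?thesis using iso signified_isomorphic_trans by blast
qed

end
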